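(* Let $d\ge1$ and let $L_m$ be the Dirichlet $L$-function obtained from a real-valued Dirichlet character $\chi_m$. Let $$\sigma_0(L_m):=\sup\{\sigma\in\mathbb{R}:\ \text{there exists } t\in\mathbb{R}\text{ such that }\operatorname{Re}L_m(\sigma+it)=0\}.$$ Let $g=g_1+ig_2\in L^\infty(\mathbb{R}^d;\mathbb{C})\cap C(\mathbb{R}^d;\mathbb{C})$, with $g_1,g_2$ real-valued, and set $I_j=\inf_{x\in\mathbb{R}^d}g_j(x)$, $S_j=\sup_{x\in\mathbb{R}^d}g_j(x)$ for $j=1,2$. If $I_1\ge\max\{1,\sigma_0(L_m)\}$ and $I_2>0$, then the local solution $u=u_1+iu_2$ ($u_1,u_2$ real-valued) of $$\partial_t u(t,x)=\Delta u(t,x)+L_m(u(t,x)),\quad x\in\mathbb{R}^d,\ t\ge0,\qquad u(0,x)=g(x),$$ is global in time and satisfies, for all $t\ge0$ and $x\in\mathbb{R}^d$, $$\max\{0,2-\zeta(I_1)\}\,t+I_1\le u_1(t,x)\le\zeta(I_1)\,t+S_1$$ and $$0<u_2(t,x)\le(\zeta(I_1)-1)\,t+S_2 .$$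
   Context: $\zeta$ is the Riemann zeta function. A Dirichlet character of period $m\in\mathbb{N}=\{1,2,3,\dots\}$ is a function $\chi_m:\mathbb{N}\to\mathbb{C}$ that is $m$-periodic, completely multiplicative, with $\chi_m(n)\ne0$ if $\gcd(n,m)=1$ and $\chi_m(n)=0$ if $\gcd(n,m)>1$. Its Dirichlet $L$-function is $L_m(s)=\sum_{n\ge1}\chi_m(n)n^{-s}$ for $\operatorname{Re}(s)>1$, extended to $\mathbb{C}$ (meromorphically with a unique pole at $s=1$ if $\chi_m(n)=1$ for all $n$ coprime to $m$, holomorphically otherwise). The local solution is the unique solution in $C([0,T);L^\infty(\mathbb{R}^d;\mathbb{C})\cap C(\mathbb{R}^d;\mathbb{C}))$, up to its maximal time of existence, in the Duhamel sense $u(t)=e^{t\Delta}g+\int_0^te^{(t-s)\Delta}L_m(u(s))\,ds$, where $e^{t\Delta}$ is convolution with the heat kernel $(4\pi t)^{-d/2}e^{-|x|^2/(4t)}$. Global in time means that the maximal time of existence is $+\infty$.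
   Formalization: Continuity of the local solution at t=0 in the sup norm is replaced by u(0)=g and u(t)-e^{tΔ}g→0 uniformly as t→0+, since for g not uniformly continuous no solution in C([0,T);L^∞∩C) exists; for uniformly continuous g the two notions agree. *)

theory Defs
  imports "HOL-Complex_Analysis.Complex_Analysis" "HOL-Library.Extended_Real"
begin

subsection \<open>Dirichlet L-functions\<close>

text \<open>
  A Dirichlet character is a function on the positive integers; the value at \<open>0\<close> is irrelevant
  and therefore left unconstrained.
\<close>

definition dirichlet_character :: "nat \<Rightarrow> (nat \<Rightarrow> complex) \<Rightarrow> bool" where
  "dirichlet_character m chi \<longleftrightarrow> m \<ge> 1 \<and>
     (\<forall>n\<ge>1. chi (n + m) = chi n) \<and>
     (\<forall>a\<ge>1. \<forall>b\<ge>1. chi (a * b) = chi a * chi b) \<and>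
     (\<forall>n\<ge>1. coprime n m \<longrightarrow> chi n \<noteq> 0) \<and>
     (\<forall>n\<ge>1. \<not> coprime n m \<longrightarrow> chi n = 0)"

definition dirichlet_series :: "(nat \<Rightarrow> complex) \<Rightarrow> complex \<Rightarrow> complex" where
  "dirichlet_series chi s = (\<Sum>n. chi (Suc n) * of_nat (Suc n) powr (-s))"

text \<open>
  The L-function is the series for \<open>Re s > 1\<close> and its meromorphic continuation elsewhere.
  The predicate \<^const>\<open>nicely_meromorphic_on\<close> fixes the value \<open>0\<close> at poles, so that the
  continuation is unique as a total function. For the principal character the only pole is
  \<open>s = 1\<close>; otherwise there is none.
\<close>

definition dirichlet_L :: "(nat \<Rightarrow> complex) \<Rightarrow> complex \<Rightarrow> complex" where
  "dirichlet_L chi s =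
     (if Re s > 1 then dirichlet_series chi s
      else (THE f. f nicely_meromorphic_on UNIV \<and>
                   (\<forall>z. Re z > 1 \<longrightarrow> f z = dirichlet_series chi z)) s)"

definition riemann_zeta :: "complex \<Rightarrow> complex" where
  "riemann_zeta = dirichlet_L (\<lambda>_. 1)"

text \<open>
  The supremum of the real parts of the points where \<open>Re f = 0\<close>, taken in the extended reals.
  Poles are excluded because the value that \<open>f\<close> takes there is only a convention.
\<close>

definition sigma0 :: "(complex \<Rightarrow> complex) \<Rightarrow> ereal" where
  "sigma0 f = Sup {ereal \<sigma> | \<sigma>. \<exists>t. \<not> is_pole f (Complex \<sigma> t) \<and> Re (f (Complex \<sigma> t)) = 0}"


subsection \<open>Mild solutions of the semilinear heat equation\<close>

definition heat_kernel :: "real \<Rightarrow> real ^ 'd \<Rightarrow> real" where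
  "heat_kernel t x =
     (4 * pi * t) powr (- real CARD('d) / 2) * exp (- (norm x)\<^sup>2 / (4 * t))"

definition heat_semigroup :: "real \<Rightarrow> (real ^ 'd \<Rightarrow> complex) \<Rightarrow> real ^ 'd \<Rightarrow> complex" where
  "heat_semigroup t f x =
     (if t = 0 then f x else (LINT y|lborel. heat_kernel t (x - y) *\<^sub>R f y))"

text \<open>
  The space of bounded continuous functions \<open>\<real>\<^sup>d \<Rightarrow> \<complex>\<close> with the supremum norm is the type
  \<open>(real ^ 'd) \<Rightarrow>\<^sub>C complex\<close>. A mild solution of \<open>\<partial>\<^sub>t u = \<Delta> u + F(u)\<close>, \<open>u(0) = g\<close>
  on \<open>[0, T)\<close> is continuous in time with values in this space and satisfies Duhamel's formula.

  Continuity at \<open>t = 0\<close> needs care: the heat flow of \<open>g\<close> converges uniformly to \<open>g\<close> as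
  \<open>t \<rightarrow> 0\<close> only if \<open>g\<close> is uniformly continuous (in general the convergence is locally uniform),
  so for general bounded continuous data no solution is norm continuous at \<open>0\<close>. We require that
  \<open>u(t)\<close> differs from the heat flow of \<open>g\<close> by a quantity tending to \<open>0\<close> in norm. This always
  gives \<open>u(t) \<rightarrow> g\<close> locally uniformly, and amounts to norm continuity at \<open>0\<close> when \<open>g\<close> is uniformly
  continuous.

  The values of \<open>u\<close> have to avoid the poles of \<open>F\<close>, where \<open>F\<close> is not defined mathematically.
\<close>

definition mild_solution ::
    "(complex \<Rightarrow> complex) \<Rightarrow> ((real ^ 'd) \<Rightarrow>\<^sub>C complex) \<Rightarrow> ereal \<Rightarrow>
     (real \<Rightarrow> ((real ^ 'd) \<Rightarrow>\<^sub>C complex)) \<Rightarrow> bool" where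
  "mild_solution F g T u \<longleftrightarrow>
     u 0 = g \<and>
     continuous_on {t. 0 < t \<and> ereal t < T} u \<and>
     uniform_limit UNIV (\<lambda>t x. u t x - heat_semigroup t g x) (\<lambda>_. 0) (at_right 0) \<and>
     (\<forall>t\<ge>0. ereal t < T \<longrightarrow>
        (\<forall>x. \<not> is_pole F (u t x)) \<and>
        (\<lambda>x. F (u t x)) \<in> bcontfun \<and>
        (\<forall>x. set_integrable lborel {0..t} (\<lambda>s. heat_semigroup (t - s) (\<lambda>y. F (u s y)) x) \<and>
             u t x = heat_semigroup t g x +
               (LINT s:{0..t}|lborel. heat_semigroup (t - s) (\<lambda>y. F (u s y)) x)))"

text \<open>
  The local solution up to its maximal time of existence \<open>T\<close>: it is a solution on \<open>[0, T)\<close>, and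
  every solution on some \<open>[0, T')\<close> is a restriction of it.
\<close>

definition maximal_mild_solution ::
    "(complex \<Rightarrow> complex) \<Rightarrow> ((real ^ 'd) \<Rightarrow>\<^sub>C complex) \<Rightarrow> ereal \<Rightarrow>
     (real \<Rightarrow> ((real ^ 'd) \<Rightarrow>\<^sub>C complex)) \<Rightarrow> bool" where
  "maximal_mild_solution F g T u \<longleftrightarrow>
     0 < T \<and> mild_solution F g T u \<and>
     (\<forall>T' v. 0 < T' \<and> mild_solution F g T' v \<longrightarrow>
        T' \<le> T \<and> (\<forall>t\<ge>0. ereal t < T' \<longrightarrow> v t = u t))"

end

theory Submission
  imports Defs "HOL-Probability.Distributions" "HOL-Number_Theory.Residues"
begin

text \<open>
  Write \<open>L\<close> for the L-function of the real character \<open>chi\<close>. Everything takes place in the half-plane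
  \<open>Re s > 1\<close>, where \<open>L\<close> is given by its Dirichlet series. The reason is that
  \<open>sigma0 L > 1\<close> for every Dirichlet character, hence \<open>I1 > 1\<close>. This strictness is essential: at \<open>I1 = 1\<close>
  the asserted bounds would involve the value \<open>0\<close> given to \<open>\<zeta>\<close> at its pole.

  \<^emph>\<open>The real part of an L-function has a zero to the right of 1.\<close> Otherwise connectedness and
  \<open>L(s) \<rightarrow> 1\<close> as \<open>Re s \<rightarrow> \<infinity>\<close> would give \<open>Re L > 0\<close> on \<open>Re s > 1\<close>. For a Dirichlet polynomial \<open>Q\<close>
  the mean value of \<open>Re L(\<sigma> + i t) |Q(t)|\<^sup>2\<close> over \<open>t\<close> is then nonnegative. By the independence of the
  numbers \<open>ln p\<close>, a Riesz product \<open>Q = \<Prod>(1 + e\<^sub>p p\<^sup>i\<^sup>t)\<close> over finitely many primes turns this into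
  \<open>Re \<Prod>(2 + e\<^sub>p chi(p) p\<^sup>-\<^sup>\<sigma>) \<ge> 0\<close> for unimodular \<open>e\<^sub>p\<close>. Choosing \<open>e\<^sub>p chi(p) = i\<close> and letting \<open>\<sigma> \<rightarrow> 1\<close>
  gives \<open>Re \<Prod>(2 + i/p) \<ge> 0\<close>. The argument of the product is \<open>\<Sum> arctan (1/(2p))\<close>, and since
  \<open>\<Sum> 1/p\<close> diverges, the primes can be chosen so that it lies between \<open>\<pi>/2\<close> and \<open>3\<pi>/2\<close>: a
  contradiction. See \<open>Re_euler_prod_nonneg\<close> and \<open>exists_zero_Re_dirichlet_L\<close>.

  \<^emph>\<open>The solution.\<close> On \<open>Re s \<ge> I1\<close> the series yields \<open>|L| \<le> \<zeta>(I1)\<close>, \<open>|L - 1| \<le> \<zeta>(I1) - 1\<close>, a Lipschitz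
  bound, and \<open>Re L \<ge> 0\<close> by the definition of \<open>sigma0\<close>. Composing \<open>L\<close> with the nearest-point
  projection onto the quadrant \<open>Re s \<ge> I1, Im s \<ge> 0\<close> gives a nonlinearity \<open>G\<close> that is bounded and
  Lipschitz on the whole plane; its mild solution \<open>u\<close> exists for all times by Banach's fixed point
  theorem. Averages of numbers in a half-plane stay in it, so bounds for \<open>Re G\<close> and \<open>Im G\<close>
  integrate to the stated linear bounds for \<open>u\<close>. In particular \<open>Re u \<ge> I1\<close>. For \<open>Im u > 0\<close>
  one uses that \<open>L\<close> is real on the real axis and has some Lipschitz constant \<open>K\<close> on \<open>Re s \<ge> I1\<close>, so
  that \<open>Im G(u) \<ge> - K Im u\<close> as long as \<open>Im u \<ge> 0\<close>, and that
  \<open>s \<mapsto> e\<^sup>(\<^sup>t\<^sup>-\<^sup>s\<^sup>)\<^sup>\<Delta> u(s)\<close> has derivative \<open>e\<^sup>(\<^sup>t\<^sup>-\<^sup>s\<^sup>)\<^sup>\<Delta> G(u(s))\<close>: the imaginary part decays at most like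
  \<open>e\<^sup>-\<^sup>K\<^sup>t\<close> and cannot reach \<open>0\<close> (\<open>Im_solution_pos\<close>). Hence \<open>u\<close> never leaves the quadrant,
  and there \<open>G = L\<close>.

  \<^emph>\<open>Uniqueness.\<close> Another mild solution \<open>v\<close> agrees with \<open>u\<close> up to some first time. Shortly after
  it, \<open>v\<close> is still so close to \<open>u\<close> that it takes values in a half-plane \<open>Re s \<ge> a\<close> with \<open>1 < a < I1\<close>, where
  \<open>L\<close> is Lipschitz, and Gronwall's argument forces \<open>v = u\<close> there as well
  (\<open>mild_solution_unique\<close>).
\<close>

section \<open>Dirichlet series in the half-plane of absolute convergence\<close>

text \<open>The value \<open>\<zeta>(a)\<close> for real \<open>a > 1\<close>.\<close>
definition zeta_sum :: "real \<Rightarrow> real" where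
  "zeta_sum a = (\<Sum>n. real (Suc n) powr (-a))"

text \<open>This is \<open>- \<zeta>'(a)\<close>; it bounds the derivative of every Dirichlet series with coefficients in
  the unit disc on \<open>Re s \<ge> a\<close>.\<close>
definition log_zeta_sum :: "real \<Rightarrow> real" where
  "log_zeta_sum a = (\<Sum>n. ln (real (Suc n)) * real (Suc n) powr (-a))"

lemma summable_zeta: "a > 1 \<Longrightarrow> summable (\<lambda>n. real (Suc n) powr (-a))"
  by (subst summable_Suc_iff) (simp add: summable_real_powr_iff)

lemma summable_log_zeta:
  assumes "a > 1"
  shows "summable (\<lambda>n. ln (real (Suc n)) * real (Suc n) powr (-a))"
proof -
  \<comment> \<open>Half of the surplus \<open>a - 1\<close> pays for the logarithm, since \<open>ln n \<le> n\<^sup>d / d\<close>.\<close>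
  define d where "d = (a - 1) / 2"
  have d: "d > 0" "a - d > 1" using assms by (auto simp: d_def field_simps)
  have le: "norm (ln (real (Suc n)) * real (Suc n) powr (-a)) \<le> real (Suc n) powr (-(a - d)) / d" for n
  proof -
    have "ln (real (Suc n)) \<le> real (Suc n) powr d / d"
      by (rule ln_powr_bound) (use d in auto)
    hence "ln (real (Suc n)) * real (Suc n) powr (-a) \<le> real (Suc n) powr d / d * real (Suc n) powr (-a)"
      by (intro mult_right_mono) auto
    also have "\<dots> = real (Suc n) powr (-(a - d)) / d"
      by (simp add: powr_add [symmetric])
    finally show ?thesis by simp
  qed
  show ?thesis
    by (rule summable_comparison_test'[OF summable_divide[OF summable_zeta[OF d(2)]] le])
qed

lemma norm_dirichlet_term_le:
  assumes "norm (chi (Suc n)) \<le> 1" "a \<le> Re s"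
  shows "norm (chi (Suc n) * of_nat (Suc n) powr (-s)) \<le> real (Suc n) powr (-a)"
proof -
  have "norm (of_nat (Suc n) powr (-s) :: complex) = real (Suc n) powr (- Re s)"
    by (subst norm_powr_real_powr) auto
  also have "\<dots> \<le> real (Suc n) powr (-a)"
    using assms by (intro powr_mono) auto
  finally have *: "norm (of_nat (Suc n) powr (-s) :: complex) \<le> real (Suc n) powr (-a)" .
  have "norm (chi (Suc n) * of_nat (Suc n) powr (-s)) \<le> 1 * real (Suc n) powr (-a)"
    unfolding norm_mult by (intro mult_mono assms *) auto
  thus ?thesis by simp
qed

context
  fixes chi :: "nat \<Rightarrow> complex"
  assumes chi_le: "\<And>n. norm (chi (Suc n)) \<le> 1"
begin

lemma summable_norm_dirichlet_series:
  assumes "Re s > 1"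
  shows "summable (\<lambda>n. norm (chi (Suc n) * of_nat (Suc n) powr (-s)))"
  using norm_dirichlet_term_le[of chi, OF chi_le order_refl, of _ s]
  by (intro summable_comparison_test'[OF summable_zeta[OF assms]]) auto

lemma summable_dirichlet_series:
  "Re s > 1 \<Longrightarrow> summable (\<lambda>n. chi (Suc n) * of_nat (Suc n) powr (-s))"
  by (rule summable_norm_cancel[OF summable_norm_dirichlet_series])

lemma norm_dirichlet_L_le:
  assumes "a > 1" "a \<le> Re s"
  shows "norm (dirichlet_L chi s) \<le> zeta_sum a"
  unfolding zeta_sum_def dirichlet_L_def dirichlet_series_def
  using assms norm_dirichlet_term_le[of chi, OF chi_le assms(2)]
  by (auto intro!: suminf_le summable_zeta  summable_norm_dirichlet_series
      order.trans[OF summable_norm] simp del: of_nat_Suc)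

lemma norm_dirichlet_L_minus_1_le:
  assumes "a > 1" "a \<le> Re s" "chi 1 = 1"
  shows "norm (dirichlet_L chi s - 1) \<le> zeta_sum a - 1"
proof -
  have s: "Re s > 1" using assms by simp
  have "dirichlet_L chi s - 1 = (\<Sum>n. chi (Suc (Suc n)) * of_nat (Suc (Suc n)) powr (-s))"
    using suminf_split_head[OF summable_dirichlet_series[OF s]] assms(3) s
    by (simp add: dirichlet_L_def dirichlet_series_def)
  also have "norm \<dots> \<le> (\<Sum>n. real (Suc (Suc n)) powr (-a))"
  proof (rule order.trans[OF summable_norm suminf_le])
    show sm: "summable (\<lambda>n. norm (chi (Suc (Suc n)) * of_nat (Suc (Suc n)) powr (-s)))"
      using summable_norm_dirichlet_series[OF s] by (subst summable_Suc_iff)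
    show "summable (\<lambda>n. real (Suc (Suc n)) powr (-a))"
      using summable_zeta[OF assms(1)] by (subst summable_Suc_iff)
    show "norm (chi (Suc (Suc n)) * of_nat (Suc (Suc n)) powr (-s)) \<le> real (Suc (Suc n)) powr (-a)" for n
      by (rule norm_dirichlet_term_le[of chi, OF chi_le assms(2)])
    thus "summable (\<lambda>n. norm (chi (Suc (Suc n)) * of_nat (Suc (Suc n)) powr (-s)))" using sm by simp
  qed
  also have "\<dots> = zeta_sum a - 1"
    unfolding zeta_sum_def using suminf_split_head[OF summable_zeta[OF assms(1)]] by simp
  finally show ?thesis .
qed

lemma dirichlet_term_lipschitz:
  assumes "a \<le> Re s" "a \<le> Re z"
  shows "norm (of_nat (Suc n) powr (-s) - of_nat (Suc n) powr (-z) :: complex)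
           \<le> ln (real (Suc n)) * real (Suc n) powr (-a) * norm (s - z)"
proof (rule field_differentiable_bound[of "{z. a \<le> Re z}"])
  show "convex {z. a \<le> Re z}" by (rule convex_halfspace_Re_ge)
  show "((\<lambda>s. of_nat (Suc n) powr (-s)) has_field_derivative
          - (Ln (of_nat (Suc n)) * of_nat (Suc n) powr (-x))) (at x within {z. a \<le> Re z})" for x :: complex
  proof -
    have "((\<lambda>s. of_nat (Suc n) powr (-s)) has_field_derivative
          Ln (of_nat (Suc n)) * of_nat (Suc n) powr (-x) * (-1)) (at x within {z. a \<le> Re z})"
      by (rule DERIV_chain'[OF _ has_field_derivative_powr_right])
        (auto intro!: derivative_eq_intros simp del: of_nat_Suc)
    thus ?thesis by simp
  qed
  show "norm (- (Ln (of_nat (Suc n)) * of_nat (Suc n) powr (-x))) \<le> ln (real (Suc n)) * real (Suc n) powr (-a)"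
    if "x \<in> {z. a \<le> Re z}" for x :: complex
  proof -
    have "norm (of_nat (Suc n) powr (-x) :: complex) \<le> real (Suc n) powr (-a)"
      using norm_dirichlet_term_le[of "\<lambda>_. 1" n a x] that by simp
    moreover have "norm (Ln (of_nat (Suc n))) = ln (real (Suc n))"
      using Ln_of_nat[of "Suc n"] by (simp add: norm_of_real del: of_nat_Suc)
    ultimately show ?thesis by (simp add: norm_mult mult_left_mono)
  qed
qed (use assms in auto)

text \<open>
  The derivative of \<open>n\<^sup>-\<^sup>s\<close> is bounded by \<open>ln n n\<^sup>-\<^sup>a\<close> on \<open>Re s \<ge> a\<close>, and the Lipschitz constants of the
  terms sum up.
\<close>

lemma dirichlet_L_lipschitz:
  assumes "a > 1"
  shows "(log_zeta_sum a)-lipschitz_on {z. a \<le> Re z} (dirichlet_L chi)"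
proof (rule lipschitz_onI)
  show "0 \<le> log_zeta_sum a"
    unfolding log_zeta_sum_def by (intro suminf_nonneg summable_log_zeta assms) auto
  fix s z assume sz: "s \<in> {z. a \<le> Re z}" "z \<in> {z. a \<le> Re z}"
  hence sm: "summable (\<lambda>n. chi (Suc n) * of_nat (Suc n) powr (-s))"
        "summable (\<lambda>n. chi (Suc n) * of_nat (Suc n) powr (-z))"
    using assms by (auto intro: summable_dirichlet_series simp del: of_nat_Suc)
  let ?b = "\<lambda>n. ln (real (Suc n)) * real (Suc n) powr (-a) * norm (s - z)"
  have le: "norm (chi (Suc n) * of_nat (Suc n) powr (-s) - chi (Suc n) * of_nat (Suc n) powr (-z)) \<le> ?b n" for n
  proof -
    have "norm (chi (Suc n) * (of_nat (Suc n) powr (-s) - of_nat (Suc n) powr (-z))) \<le> 1 * ?b n"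
      unfolding norm_mult by (intro mult_mono chi_le dirichlet_term_lipschitz) (use sz in auto)
    thus ?thesis by (simp add: algebra_simps)
  qed
  have smb: "summable ?b" by (intro summable_mult2 summable_log_zeta assms)
  have "dirichlet_L chi s - dirichlet_L chi z
      = (\<Sum>n. chi (Suc n) * of_nat (Suc n) powr (-s) - chi (Suc n) * of_nat (Suc n) powr (-z))"
    using sz assms suminf_diff[OF sm] by (simp add: dirichlet_L_def dirichlet_series_def)
  also have "norm \<dots> \<le> (\<Sum>n. ?b n)"
    by (rule norm_suminf_le[OF le smb])
  also have "\<dots> = log_zeta_sum a * norm (s - z)"
    unfolding log_zeta_sum_def by (rule suminf_mult2[symmetric, OF summable_log_zeta[OF assms]])
  finally show "dist (dirichlet_L chi s) (dirichlet_L chi z) \<le> log_zeta_sum a * dist s z"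
    by (simp add: dist_norm)
qed

lemma continuous_on_dirichlet_L: "continuous_on {s. Re s > 1} (dirichlet_L chi)"
proof (intro continuous_at_imp_continuous_on ballI)
  fix s :: complex assume s: "s \<in> {s. Re s > 1}"
  define a where "a = (1 + Re s) / 2"
  have a: "a > 1" "a < Re s" using s by (auto simp: a_def field_simps)
  have "continuous_on {z. a < Re z} (dirichlet_L chi)"
    by (rule continuous_on_subset[OF lipschitz_on_continuous_on[OF dirichlet_L_lipschitz[OF a(1)]]]) auto
  thus "isCont (dirichlet_L chi) s"
    using a by (auto simp: continuous_on_eq_continuous_at open_halfspace_Re_gt)
qed

lemma not_is_pole_dirichlet_L:
  assumes "Re s > 1"
  shows "\<not> is_pole (dirichlet_L chi) s"
proof -
  have "isCont (dirichlet_L chi) s"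
    using continuous_on_dirichlet_L assms
    by (auto simp: continuous_on_eq_continuous_at open_halfspace_Re_gt)
  thus ?thesis
    unfolding is_pole_def isCont_def using not_tendsto_and_filterlim_at_infinity[OF at_neq_bot] by blast
qed

text \<open>
  With real coefficients the function is real on the real axis, so its imaginary part at \<open>s\<close> is
  that of its difference from the value at \<open>Re s\<close>.
\<close>

lemma abs_Im_dirichlet_L_le:
  assumes "a > 1" "a \<le> Re s" and real: "\<And>n. chi (Suc n) \<in> \<real>"
  shows "\<bar>Im (dirichlet_L chi s)\<bar> \<le> log_zeta_sum a * \<bar>Im s\<bar>"
proof -
  have "chi (Suc n) * of_nat (Suc n) powr (- of_real (Re s)) \<in> \<real>" for n
  proof -
    have "(of_nat (Suc n) powr (- of_real (Re s)) :: complex) = of_real (real (Suc n) powr (- Re s))"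
      by (subst powr_of_real[symmetric]) auto
    thus ?thesis using real by (auto intro!: Reals_mult)
  qed
  hence "dirichlet_L chi (of_real (Re s)) \<in> \<real>"
    using summable_dirichlet_series[of "of_real (Re s)"] assms
    by (auto simp: dirichlet_L_def dirichlet_series_def complex_is_Real_iff Im_suminf simp del: of_nat_Suc times_complex.sel)
  hence "Im (dirichlet_L chi s) = Im (dirichlet_L chi s - dirichlet_L chi (of_real (Re s)))"
    by (simp add: complex_is_Real_iff)
  also have "\<bar>\<dots>\<bar> \<le> dist (dirichlet_L chi s) (dirichlet_L chi (of_real (Re s)))"
    unfolding dist_norm by (rule abs_Im_le_cmod)
  also have "\<dots> \<le> log_zeta_sum a * dist s (of_real (Re s))"
    by (rule lipschitz_onD[OF dirichlet_L_lipschitz[OF assms(1)]]) (use assms in auto)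
  also have "dist s (of_real (Re s)) = \<bar>Im s\<bar>"
    by (simp add: dist_norm cmod_def)
  finally show ?thesis .
qed

end

lemma Re_riemann_zeta:
  assumes "a > 1"
  shows "Re (riemann_zeta (of_real a)) = zeta_sum a"
proof -
  have "(of_nat (Suc n) powr (- of_real a) :: complex) = of_real (real (Suc n) powr (- a))" for n
    by (subst powr_of_real[symmetric]) auto
  thus ?thesis using assms
    by (simp add: riemann_zeta_def dirichlet_L_def dirichlet_series_def zeta_sum_def
        suminf_of_real[OF summable_zeta, symmetric] del: of_nat_Suc)
qed

text \<open>
  Since \<open>n \<ge> 2\<close> in all terms but the first, raising the exponent by \<open>k\<close> shrinks the rest of the
  series by the factor \<open>2\<^sup>-\<^sup>k\<close>.
\<close>

lemma zeta_sum_lt_2: "\<exists>a>1. zeta_sum a < 2"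
proof -
  let ?S = "\<Sum>n. real (Suc (Suc n)) powr (-2)"
  have sm2: "summable (\<lambda>n. real (Suc (Suc n)) powr (-a))" if "a > 1" for a
    using summable_zeta[OF that] by (subst summable_Suc_iff)
  have le: "zeta_sum (2 + real k) \<le> 1 + (1/2) ^ k * ?S" for k
  proof -
    have "real (Suc (Suc n)) powr (-(2 + real k)) \<le> (1/2) ^ k * real (Suc (Suc n)) powr (-2)" for n
    proof -
      have "real (Suc (Suc n)) powr (- real k) \<le> 2 powr (- real k)"
        by (rule powr_mono2') auto
      also have "\<dots> = (1/2) ^ k" by (simp add: powr_minus powr_realpow power_one_over field_simps)
      finally show ?thesis
        by (simp add: powr_add[symmetric] powr_diff field_simps powr_minus divide_right_mono)
    qed
    hence "(\<Sum>n. real (Suc (Suc n)) powr (-(2 + real k))) \<le> (\<Sum>n. (1/2) ^ k * real (Suc (Suc n)) powr (-2))"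
      by (intro suminf_le summable_mult sm2) auto
    also have "\<dots> = (1/2) ^ k * ?S" by (intro suminf_mult sm2) auto
    finally show ?thesis
      unfolding zeta_sum_def using suminf_split_head[OF summable_zeta[of "2 + real k"]] by simp
  qed
  have "(\<lambda>k. 1 + (1/2) ^ k * ?S) \<longlonglongrightarrow> 1 + 0 * ?S"
    by (intro tendsto_intros LIMSEQ_power_zero) auto
  hence "eventually (\<lambda>k. 1 + (1/2) ^ k * ?S < 2) sequentially"
    by (rule order_tendstoD) auto
  then obtain k where "1 + (1/2) ^ k * ?S < 2" by (auto simp: eventually_sequentially)
  with le[of k] show ?thesis by (intro exI[of _ "2 + real k"]) auto
qed

text \<open>
  The half-plane is connected, and the real part is positive far to the right, where
  \<open>|L - 1| < 1\<close>.
\<close>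

lemma Re_dirichlet_L_pos:
  assumes chi: "\<And>n. norm (chi (Suc n)) \<le> 1" "chi 1 = 1" and b: "b \<ge> 1"
    and nz: "\<And>s. Re s > b \<Longrightarrow> Re (dirichlet_L chi s) \<noteq> 0" and s: "Re s > b"
  shows "Re (dirichlet_L chi s) > 0"
proof (rule ccontr)
  assume "\<not> Re (dirichlet_L chi s) > 0"
  hence neg: "Re (dirichlet_L chi s) \<le> 0" by simp
  obtain c where c: "c > 1" "zeta_sum c < 2" using zeta_sum_lt_2 by blast
  define w :: complex where "w = of_real (max c (b + 1))"
  have w: "Re w > b" "Re w \<ge> c" by (auto simp: w_def)
  have "\<bar>Re (dirichlet_L chi w - 1)\<bar> \<le> zeta_sum c - 1"
    using norm_dirichlet_L_minus_1_le[of chi, OF chi(1) c(1) w(2) chi(2)] abs_Re_le_cmod order.trans by blast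
  hence pos: "Re (dirichlet_L chi w) > 0" using c by simp
  have "connected ((\<lambda>z. Re (dirichlet_L chi z)) ` {z. Re z > b})"
    using b by (intro connected_continuous_image continuous_intros
        continuous_on_subset[OF continuous_on_dirichlet_L[of chi, OF chi(1)]])
      (auto intro!: convex_connected convex_halfspace_Re_gt)
  hence "0 \<in> (\<lambda>z. Re (dirichlet_L chi z)) ` {z. Re z > b}"
    by (rule connectedD_interval) (use w s neg pos in auto)
  with nz show False by force
qed

lemma Re_dirichlet_L_nonneg:
  assumes chi: "\<And>n. norm (chi (Suc n)) \<le> 1" "chi 1 = 1" and b: "b > 1"
    and nz: "\<And>s. Re s > b \<Longrightarrow> Re (dirichlet_L chi s) \<noteq> 0" and s: "Re s \<ge> b"
  shows "Re (dirichlet_L chi s) \<ge> 0"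
proof (rule tendsto_lowerbound)
  have "isCont (dirichlet_L chi) s"
    using continuous_on_dirichlet_L[of chi, OF chi(1)] b s
    by (auto simp: continuous_on_eq_continuous_at open_halfspace_Re_gt)
  moreover have "(\<lambda>n. s + of_real (1 / real (Suc n))) \<longlonglongrightarrow> s + of_real 0"
    by (intro tendsto_intros LIMSEQ_Suc lim_1_over_n)
  ultimately show "(\<lambda>n. Re (dirichlet_L chi (s + of_real (1 / real (Suc n))))) \<longlonglongrightarrow> Re (dirichlet_L chi s)"
    using isCont_tendsto_compose by (intro tendsto_Re) fastforce
  show "\<forall>\<^sub>F n in sequentially. 0 \<le> Re (dirichlet_L chi (s + of_real (1 / real (Suc n))))"
  proof (intro always_eventually allI)
    fix n
    have "1 / real (Suc n) > 0" by simp
    hence "Re (s + of_real (1 / real (Suc n))) > b"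
      unfolding plus_complex.sel Re_complex_of_real using s by linarith
    thus "0 \<le> Re (dirichlet_L chi (s + of_real (1 / real (Suc n))))"
      using b Re_dirichlet_L_pos[of chi b, OF chi(1) chi(2) _ nz] by (intro less_imp_le) auto
  qed
qed auto

section \<open>Primes and the argument of a finite product\<close>

lemma prod_prime_powers_multiplicity:
  fixes n :: nat
  assumes "n > 0" "finite P" "prime_factors n \<subseteq> P" "\<And>p. p \<in> P \<Longrightarrow> prime p"
  shows "(\<Prod>p\<in>P. p ^ multiplicity p n) = n"
proof -
  have "(\<Prod>p\<in>P. p ^ multiplicity p n) = (\<Prod>p\<in>prime_factors n. p ^ multiplicity p n)"
    using assms by (intro prod.mono_neutral_right) (auto simp: prime_factors_multiplicity)
  also have "\<dots> = n" using assms(1) by (simp add: prod_prime_factors)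
  finally show ?thesis .
qed

text \<open>
  Euler's argument: expanding \<open>\<Prod>(1 + 1/p + \<dots> + 1/p\<^sup>N)\<close> over the primes \<open>p \<le> N\<close> produces every \<open>1/n\<close>
  with \<open>n \<le> N\<close>, and each factor is at most \<open>exp(2/p)\<close>.
\<close>

lemma harm_le_exp_sum_primes:
  "harm N \<le> exp (2 * (\<Sum>p | prime p \<and> p \<le> N. 1 / real p))"
proof -
  define P where "P = {p. prime p \<and> p \<le> N}"
  have fin: "finite P" unfolding P_def by (rule finite_subset[of _ "{..N}"]) auto
  have P: "prime p" "p \<le> N" if "p \<in> P" for p using that by (auto simp: P_def)
  have pf: "prime_factors n \<subseteq> P" if "n \<in> {1..N}" for n
  proof
    fix p assume "p \<in> prime_factors n"
    hence "prime p" "p dvd n" by auto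
    thus "p \<in> P" using dvd_imp_le[of p n] that by (auto simp: P_def)
  qed
  \<comment> \<open>The exponent vector of \<open>n\<close>, by which its reciprocal is found in the expanded product.\<close>
  define h where "h = (\<lambda>n. \<lambda>p\<in>P. multiplicity p n)"
  have prod: "(\<Prod>p\<in>P. p ^ multiplicity p n) = n" if "n \<in> {1..N}" for n
    using that by (intro prod_prime_powers_multiplicity fin pf P) auto
  have "inj_on h {1..N}"
  proof (rule inj_onI)
    fix n k assume nk: "n \<in> {1..N}" "k \<in> {1..N}" "h n = h k"
    have "multiplicity p n = multiplicity p k" if "p \<in> P" for p
      using fun_cong[OF nk(3), of p] that by (simp add: h_def)
    hence "(\<Prod>p\<in>P. p ^ multiplicity p n) = (\<Prod>p\<in>P. p ^ multiplicity p k)" by simp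
    thus "n = k" using prod nk by simp
  qed
  have "h n \<in> PiE P (\<lambda>_. {..N})" if n: "n \<in> {1..N}" for n
  proof -
    have "multiplicity p n \<le> N" if "p \<in> P" for p
    proof -
      have "p ^ multiplicity p n dvd n" by (rule multiplicity_dvd)
      hence "p ^ multiplicity p n \<le> n" using n by (intro dvd_imp_le) auto
      moreover have "multiplicity p n < p ^ multiplicity p n"
        using prime_gt_1_nat[OF P(1)[OF that]] by (intro power_gt_expt) simp
      ultimately show ?thesis using n by simp
    qed
    thus ?thesis by (auto simp: h_def)
  qed
  hence sub: "h ` {1..N} \<subseteq> PiE P (\<lambda>_. {..N})" by blast
  have "harm N = (\<Sum>n\<in>{1..N}. \<Prod>p\<in>P. (1 / real p) ^ h n p)"
    unfolding harm_def
  proof (rule sum.cong[OF refl])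
    fix n assume n: "n \<in> {1..N}"
    have "real n = (\<Prod>p\<in>P. real p ^ multiplicity p n)"
      using arg_cong[OF prod[OF n, symmetric], of real] by (simp only: of_nat_prod of_nat_power)
    hence "inverse (real n) = inverse (\<Prod>p\<in>P. real p ^ multiplicity p n)" by (rule arg_cong)
    also have "\<dots> = (\<Prod>p\<in>P. inverse (real p ^ multiplicity p n))" by (rule prod_inversef[unfolded o_def, symmetric])
    also have "\<dots> = (\<Prod>p\<in>P. (1 / real p) ^ h n p)"
      by (intro prod.cong) (auto simp: h_def power_one_over inverse_eq_divide)
    finally show "inverse (real n) = (\<Prod>p\<in>P. (1 / real p) ^ h n p)" .
  qed
  also have "\<dots> = (\<Sum>f\<in>h ` {1..N}. \<Prod>p\<in>P. (1 / real p) ^ f p)"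
    using \<open>inj_on h {1..N}\<close> by (simp add: sum.reindex)
  also have "\<dots> \<le> (\<Sum>f\<in>PiE P (\<lambda>_. {..N}). \<Prod>p\<in>P. (1 / real p) ^ f p)"
    by (rule sum_mono2) (use sub fin in \<open>auto intro!: finite_PiE prod_nonneg\<close>)
  also have "\<dots> = (\<Prod>p\<in>P. \<Sum>k\<le>N. (1 / real p) ^ k)"
    by (rule prod_sum_PiE[symmetric]) (use fin in auto)
  also have "\<dots> \<le> (\<Prod>p\<in>P. exp (2 * (1 / real p)))"
  proof (rule prod_mono, safe)
    fix p assume "p \<in> P"
    hence p: "real p \<ge> 2" using P(1)[of p] by (simp add: prime_ge_2_nat)
    define x where "x = 1 / real p"
    have x: "0 < x" "x \<le> 1 / 2" using p by (auto simp: x_def field_simps)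
    show "0 \<le> (\<Sum>k\<le>N. (1 / real p) ^ k)" by (intro sum_nonneg) auto
    have "(\<Sum>k\<le>N. x ^ k) = (1 - x ^ Suc N) / (1 - x)"
      using x by (subst sum_gp0) auto
    also have "\<dots> \<le> 1 / (1 - x)" using x by (intro divide_right_mono) auto
    also have "\<dots> \<le> 1 + 2 * x"
    proof -
      have "x * x \<le> x * (1 / 2)" using x by (intro mult_left_mono) auto
      thus ?thesis using x by (simp add: field_simps)
    qed
    also have "\<dots> \<le> exp (2 * x)" by (rule exp_ge_add_one_self)
    finally show "(\<Sum>k\<le>N. (1 / real p) ^ k) \<le> exp (2 * (1 / real p))" by (simp add: x_def)
  qed
  also have "\<dots> = exp (2 * (\<Sum>p\<in>P. 1 / real p))"
    using fin by (simp add: exp_sum sum_distrib_left)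
  finally show ?thesis by (simp add: P_def)
qed

lemma sum_inverse_primes_unbounded: "\<exists>N. C < (\<Sum>p | prime p \<and> p \<le> N. 1 / real p)"
proof -
  have "eventually (\<lambda>N. exp (2 * C) < (harm N :: real)) sequentially"
    using harm_at_top by (auto simp: filterlim_at_top_dense)
  then obtain N where "exp (2 * C) < (harm N :: real)" by (auto simp: eventually_sequentially)
  also have "\<dots> \<le> exp (2 * (\<Sum>p | prime p \<and> p \<le> N. 1 / real p))" by (rule harm_le_exp_sum_primes)
  finally show ?thesis by (intro exI[of _ N]) simp
qed

lemma half_le_arctan:
  assumes "0 \<le> x" "x \<le> 1"
  shows "x / 2 \<le> arctan x"
proof (cases "x = 0")
  case False
  hence x: "x > 0" using assms by simp
  have "\<exists>z>0. z < x \<and> arctan x - arctan 0 = (x - 0) * inverse (1 + z\<^sup>2)"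
    by (rule MVT2[OF x]) (auto intro!: DERIV_arctan)
  then obtain z where z: "0 < z" "z < x" "arctan x = x * inverse (1 + z\<^sup>2)" by auto
  have "z\<^sup>2 \<le> 1" using z assms by (intro power_le_one) auto
  hence "inverse (1 + z\<^sup>2) \<ge> inverse 2" by (intro le_imp_inverse_le) (auto intro: add_pos_nonneg)
  hence "x * inverse 2 \<le> x * inverse (1 + z\<^sup>2)" using x by (intro mult_left_mono) auto
  thus ?thesis unfolding z(3) divide_inverse .
qed simp

text \<open>
  As \<open>arctan (1/(2p)) \<ge> 1/(4p)\<close>, the sums over the primes up to \<open>N\<close> are unbounded in \<open>N\<close>. Each step
  adds less than \<open>\<pi>/2\<close>, so the first sum exceeding \<open>\<pi>/2\<close> is still below \<open>3\<pi>/2\<close>.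
\<close>

lemma exists_primes_arctan_sum:
  assumes "m > 0"
  shows "\<exists>P. finite P \<and> (\<forall>p\<in>P. prime p \<and> \<not> p dvd m) \<and>
           pi / 2 < (\<Sum>p\<in>P. arctan (1 / (2 * real p))) \<and> (\<Sum>p\<in>P. arctan (1 / (2 * real p))) < 3 * pi / 2"
proof -
  define Q where "Q = (\<lambda>N. {p. prime p \<and> \<not> p dvd m \<and> p \<le> N})"
  define F where "F = (\<lambda>N. \<Sum>p\<in>Q N. arctan (1 / (2 * real p)))"
  have finQ: "finite (Q N)" for N unfolding Q_def by (rule finite_subset[of _ "{..N}"]) auto
  have "\<exists>N. F N > pi / 2"
  proof -
    \<comment> \<open>Leaving out the primes dividing \<open>m\<close> changes the sum by a constant only.\<close>
    define D where "D = {p. prime p \<and> p dvd m}"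
    have finD: "finite D"
      unfolding D_def by (rule finite_subset[of _ "{..m}"]) (use assms in \<open>auto dest: dvd_imp_le\<close>)
    obtain N where N: "2 * pi + (\<Sum>p\<in>D. 1 / real p) < (\<Sum>p | prime p \<and> p \<le> N. 1 / real p)"
      using sum_inverse_primes_unbounded by blast
    have "(\<Sum>p | prime p \<and> p \<le> N. 1 / real p) \<le> (\<Sum>p\<in>Q N \<union> D. 1 / real p)"
      by (rule sum_mono2) (use finQ finD in \<open>auto simp: Q_def D_def\<close>)
    also have "\<dots> = (\<Sum>p\<in>Q N. 1 / real p) + (\<Sum>p\<in>D. 1 / real p)"
      by (rule sum.union_disjoint) (use finQ finD in \<open>auto simp: Q_def D_def\<close>)
    finally have "2 * pi < (\<Sum>p\<in>Q N. 1 / real p)" using N by linarith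
    also have "\<dots> = 4 * (\<Sum>p\<in>Q N. (1 / (2 * real p)) / 2)"
      unfolding sum_distrib_left by (intro sum.cong) auto
    finally have "pi / 2 < (\<Sum>p\<in>Q N. (1 / (2 * real p)) / 2)" by linarith
    also have "(\<Sum>p\<in>Q N. (1 / (2 * real p)) / 2) \<le> F N"
      unfolding F_def
    proof (intro sum_mono half_le_arctan)
      fix p assume "p \<in> Q N"
      hence "real p \<ge> 2" using prime_ge_2_nat[of p] by (simp add: Q_def)
      thus "1 / (2 * real p) \<le> 1" "0 \<le> 1 / (2 * real p)" by (simp_all add: field_simps)
    qed
    finally show ?thesis by blast
  qed
  define N where "N = (LEAST N. F N > pi / 2)"
  have N: "F N > pi / 2" unfolding N_def by (rule LeastI_ex) fact
  have Q0: "Q 0 = {}" by (auto simp: Q_def dest: prime_gt_0_nat)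
  have "N \<noteq> 0" using N pi_gt_zero by (intro notI) (simp add: F_def Q0)
  then obtain K where K: "N = Suc K" by (cases N) auto
  have "\<not> F K > pi / 2" using not_less_Least[of K "\<lambda>N. F N > pi / 2"] K by (simp add: N_def)
  moreover have "F N \<le> F K + pi / 2"
  proof (cases "Suc K \<in> Q N")
    case True
    hence "Q N = insert (Suc K) (Q K)" "Suc K \<notin> Q K" by (auto simp: Q_def K)
    hence "F N = arctan (1 / (2 * real (Suc K))) + F K" using finQ[of K] by (simp add: F_def)
    thus ?thesis using arctan_ubound[of "1 / (2 * real (Suc K))"] by linarith
  next
    case False
    hence "Q N = Q K" by (auto simp: Q_def K le_Suc_eq)
    thus ?thesis by (simp add: F_def)
  qed
  ultimately have "F N < 3 * pi / 2" using pi_gt_zero by linarith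
  thus ?thesis using N finQ[of N] by (intro exI[of _ "Q N"]) (auto simp: F_def Q_def)
qed

lemma prod_cis: "finite P \<Longrightarrow> (\<Prod>p\<in>P. cis (\<theta> p)) = cis (\<Sum>p\<in>P. \<theta> p)"
proof (induction P rule: finite_induct)
  case (insert p P)
  thus ?case by (simp add: cis_mult)
qed simp

lemma one_plus_i_eq_cis: "1 + \<i> * of_real x = of_real (sqrt (1 + x\<^sup>2)) * cis (arctan x)"
proof -
  have "1 + x\<^sup>2 > 0" by (rule add_pos_nonneg) auto
  hence "sqrt (1 + x\<^sup>2) > 0" by simp
  thus ?thesis unfolding complex_eq_iff by (simp add: cos_arctan sin_arctan)
qed

text \<open>
  The factor \<open>2 + i/p\<close> has argument \<open>arctan (1/(2p))\<close>, and arguments add up.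
\<close>

lemma exists_primes_Re_prod_neg:
  assumes "m > 0"
  shows "\<exists>P. finite P \<and> (\<forall>p\<in>P. prime p \<and> \<not> p dvd m) \<and> Re (\<Prod>p\<in>P. 2 + \<i> * of_real (1 / real p)) < 0"
proof -
  obtain P where P: "finite P" "\<forall>p\<in>P. prime p \<and> \<not> p dvd m"
    and s: "pi / 2 < (\<Sum>p\<in>P. arctan (1 / (2 * real p)))" "(\<Sum>p\<in>P. arctan (1 / (2 * real p))) < 3 * pi / 2"
    using exists_primes_arctan_sum[OF assms] by blast
  let ?S = "\<Sum>p\<in>P. arctan (1 / (2 * real p))"
  define r where "r = (\<lambda>p. 2 * sqrt (1 + (1 / (2 * real p))\<^sup>2))"
  have "(\<Prod>p\<in>P. 2 + \<i> * of_real (1 / real p)) = (\<Prod>p\<in>P. of_real (r p) * cis (arctan (1 / (2 * real p))))"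
  proof (rule prod.cong[OF refl])
    fix p
    have "2 + \<i> * of_real (1 / real p) = 2 * (1 + \<i> * of_real (1 / (2 * real p)))" by simp
    also have "\<dots> = of_real (r p) * cis (arctan (1 / (2 * real p)))"
      unfolding one_plus_i_eq_cis by (simp add: r_def)
    finally show "2 + \<i> * of_real (1 / real p) = of_real (r p) * cis (arctan (1 / (2 * real p)))" .
  qed
  also have "\<dots> = of_real (\<Prod>p\<in>P. r p) * cis ?S"
    by (simp only: prod.distrib prod_cis[OF P(1)] of_real_prod)
  moreover have "Re (of_real x * cis y) = x * cos y" for x y by simp
  ultimately have "Re (\<Prod>p\<in>P. 2 + \<i> * of_real (1 / real p)) = (\<Prod>p\<in>P. r p) * cos ?S" by (simp only:)
  moreover have "(\<Prod>p\<in>P. r p) > 0" by (intro prod_pos) (auto simp: r_def add_pos_nonneg)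
  moreover have "cos ?S < 0"
  proof -
    have "cos (?S - pi) > 0" using s by (intro cos_gt_zero_pi) auto
    thus ?thesis by (simp add: cos_diff)
  qed
  ultimately show ?thesis using P by (intro exI[of _ P]) (auto simp: mult_pos_neg)
qed

section \<open>A zero of the real part to the right of 1\<close>

text \<open>
  The mean value of a trigonometric polynomial is the sum of its coefficients of frequency \<open>0\<close>.
  Instead of forming means, use the antiderivative: its real part is nondecreasing and
  equals \<open>t\<close> times the real part of that sum, up to a bounded error.
\<close>

lemma Re_mean_nonneg:
  fixes a :: "'j \<Rightarrow> complex" and l :: "'j \<Rightarrow> real"
  assumes J: "finite J" and nn: "\<And>t. 0 \<le> Re (\<Sum>j\<in>J. a j * exp (\<i> * of_real (l j * t)))"
  shows "0 \<le> Re (\<Sum>j | j \<in> J \<and> l j = 0. a j)"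
proof (rule ccontr)
  define c where "c = Re (\<Sum>j | j \<in> J \<and> l j = 0. a j)"
  assume "\<not> ?thesis"
  hence c: "c < 0" by (simp add: c_def)
  \<comment> \<open>The antiderivative of \<open>e\<^sup>i\<^sup>l\<^sup>t\<close> that vanishes at \<open>0\<close>; it is bounded unless \<open>l = 0\<close>.\<close>
  define E where "E = (\<lambda>j t. if l j = 0 then of_real t else (exp (\<i> * of_real (l j * t)) - 1) / (\<i> * of_real (l j)))"
  define B where "B = (\<Sum>j\<in>J. if l j = 0 then 0 else norm (a j) * (2 / \<bar>l j\<bar>))"
  have B: "B \<ge> 0" unfolding B_def by (intro sum_nonneg) auto
  have dE: "(E j has_vector_derivative exp (\<i> * of_real (l j * t))) (at t)" for j t
  proof (cases "l j = 0")
    case True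
    have "(of_real has_vector_derivative (of_real 1 :: complex)) (at t)"
      by (rule has_vector_derivative_of_real[OF DERIV_ident])
    thus ?thesis using True by (simp add: E_def)
  next
    case False
    have "((\<lambda>z. (exp (\<i> * of_real (l j) * z) - 1) / (\<i> * of_real (l j))) has_field_derivative exp (\<i> * of_real (l j) * of_real t)) (at (of_real t))"
      using False by (auto intro!: derivative_eq_intros)
    from has_vector_derivative_real_field[OF this] show ?thesis
      using False by (simp add: E_def mult.assoc o_def)
  qed
  define G where "G = (\<lambda>t. Re (\<Sum>j\<in>J. a j * E j t))"
  have dG: "(G has_real_derivative Re (\<Sum>j\<in>J. a j * exp (\<i> * of_real (l j * t)))) (at t)" for t
    unfolding G_def has_real_derivative_iff_has_vector_derivative
    by (intro bounded_linear.has_vector_derivative[OF bounded_linear_Re] has_vector_derivative_sum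
          has_vector_derivative_mult_right dE)
  have "G t \<le> t * c + B" if "t \<ge> 0" for t
  proof -
    have "(\<Sum>j\<in>J. a j * E j t) = (\<Sum>j\<in>J. (if l j = 0 then of_real t * a j else 0) + (if l j = 0 then 0 else a j * E j t))"
      by (intro sum.cong) (auto simp: E_def)
    also have "\<dots> = of_real t * (\<Sum>j | j \<in> J \<and> l j = 0. a j) + (\<Sum>j\<in>J. if l j = 0 then 0 else a j * E j t)"
      unfolding sum.distrib sum.inter_filter[OF J, symmetric] sum_distrib_left by simp
    moreover have "Re (of_real t * z + z') = t * Re z + Re z'" for z z' by simp
    ultimately have "G t = t * c + Re (\<Sum>j\<in>J. if l j = 0 then 0 else a j * E j t)"
      by (simp only: G_def c_def)
    moreover have "norm (\<Sum>j\<in>J. if l j = 0 then 0 else a j * E j t) \<le> B"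
      unfolding B_def
    proof (rule sum_norm_le)
      fix j
      have "norm (E j t) \<le> 2 / \<bar>l j\<bar>" if "l j \<noteq> 0"
      proof -
        have "norm (exp (\<i> * of_real (l j * t)) - 1) \<le> 2"
          using norm_triangle_ineq4[of "exp (\<i> * of_real (l j * t))" 1] by simp
        thus ?thesis using that by (simp add: E_def norm_divide norm_mult divide_right_mono)
      qed
      thus "norm (if l j = 0 then 0 else a j * E j t) \<le> (if l j = 0 then 0 else norm (a j) * (2 / \<bar>l j\<bar>))"
        by (auto simp: norm_mult simp del: times_divide_eq_right intro!: mult_left_mono)
    qed
    ultimately show ?thesis
      using complex_Re_le_cmod[of "\<Sum>j\<in>J. if l j = 0 then 0 else a j * E j t"] by linarith
  qed
  moreover have "G 0 \<le> G t" if "t \<ge> 0" for t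
    by (rule DERIV_nonneg_imp_nondecreasing[OF that]) (use dG nn in blast)
  moreover have "E j 0 = 0" for j by (simp add: E_def)
  hence "G 0 = 0" by (simp add: G_def)
  ultimately have "0 \<le> t * c + B" if "t \<ge> 0" for t
    using that by (metis order.trans)
  moreover have "0 \<le> (B + 1) / (- c)" using c B by (intro divide_nonneg_pos) auto
  ultimately have "0 \<le> (B + 1) / (- c) * c + B" by blast
  also have "(B + 1) / (- c) * c = - (B + 1)" using c by simp
  finally show False by simp
qed

text \<open>
  With \<open>Q(t) = \<Sum> w\<^sub>i q\<^sub>i\<^sup>i\<^sup>t\<close>, the sum in the conclusion is the mean value of \<open>(\<Sum> b\<^sub>n n\<^sup>-\<^sup>i\<^sup>t) |Q(t)|\<^sup>2\<close>: the
  frequency \<open>ln q\<^sub>i - ln q\<^sub>j - ln n\<close> vanishes exactly if \<open>n q\<^sub>j = q\<^sub>i\<close>.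
\<close>

lemma Re_toeplitz_nonneg:
  fixes b :: "nat \<Rightarrow> complex" and w :: "'i \<Rightarrow> complex" and q :: "'i \<Rightarrow> nat"
  assumes S: "finite S" "\<And>n. n \<in> S \<Longrightarrow> n > 0" and I: "finite I" "\<And>i. i \<in> I \<Longrightarrow> q i > 0"
    and nn: "\<And>t. 0 \<le> Re (\<Sum>n\<in>S. b n * exp (- (\<i> * of_real (ln (real n) * t))))"
  shows "0 \<le> Re (\<Sum>(n, i, j) | n \<in> S \<and> i \<in> I \<and> j \<in> I \<and> n * q j = q i. b n * w i * cnj (w j))"
proof -
  define J where "J = S \<times> I \<times> I"
  define a where "a = (\<lambda>(n, i, j). b n * w i * cnj (w j))"
  define l where "l = (\<lambda>(n, i, j). ln (real (q i)) - ln (real (q j)) - ln (real n))"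
  have l0: "l (n, i, j) = 0 \<longleftrightarrow> n * q j = q i" if "n \<in> S" "i \<in> I" "j \<in> I" for n i j
  proof -
    have pos: "real n > 0" "real (q i) > 0" "real (q j) > 0" using S(2) I(2) that by auto
    have "l (n, i, j) = 0 \<longleftrightarrow> ln (real (q i)) = ln (real n * real (q j))"
      using pos by (simp add: l_def ln_mult) linarith
    also have "\<dots> \<longleftrightarrow> real (q i) = real n * real (q j)"
      using pos by (intro ln_inj_iff) auto
    also have "\<dots> \<longleftrightarrow> q i = n * q j"
      by (metis of_nat_eq_iff of_nat_mult)
    finally show ?thesis by auto
  qed
  have "0 \<le> Re (\<Sum>j | j \<in> J \<and> l j = 0. a j)"
  proof (rule Re_mean_nonneg)
    show "finite J" using S I by (simp add: J_def)
    fix t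
    define Q where "Q = (\<Sum>i\<in>I. w i * exp (\<i> * of_real (ln (real (q i)) * t)))"
    define L where "L = (\<Sum>n\<in>S. b n * exp (- (\<i> * of_real (ln (real n) * t))))"
    have cQ: "cnj Q = (\<Sum>j\<in>I. cnj (w j) * exp (- (\<i> * of_real (ln (real (q j)) * t))))"
      by (simp add: Q_def exp_cnj)
    define e where "e = (\<lambda>k. exp (\<i> * of_real (ln (real k) * t)))"
    define e' where "e' = (\<lambda>k. exp (- (\<i> * of_real (ln (real k) * t))))"
    have Le: "L = (\<Sum>n\<in>S. b n * e' n)" by (simp only: L_def e'_def)
    have "(\<Sum>j\<in>J. a j * exp (\<i> * of_real (l j * t)))
       = (\<Sum>(n, i, j)\<in>J. (b n * e' n) * ((w i * e (q i)) * (cnj (w j) * e' (q j))))"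
    proof (rule sum.cong[OF refl], clarify)
      fix n i j
      have "exp (\<i> * of_real (l (n, i, j) * t)) = e' n * (e (q i) * e' (q j))"
        unfolding e_def e'_def exp_add[symmetric] l_def by (simp add: algebra_simps)
      thus "a (n, i, j) * exp (\<i> * of_real (l (n, i, j) * t)) = (b n * e' n) * ((w i * e (q i)) * (cnj (w j) * e' (q j)))"
        by (simp add: a_def)
    qed
    also have "\<dots> = L * (\<Sum>(i, j)\<in>I \<times> I. (w i * e (q i)) * (cnj (w j) * e' (q j)))"
      unfolding Le J_def sum_product sum.cartesian_product by (simp add: split_def)
    also have "(\<Sum>(i, j)\<in>I \<times> I. (w i * e (q i)) * (cnj (w j) * e' (q j))) = Q * cnj Q"
      unfolding cQ unfolding Q_def sum_product sum.cartesian_product e_def e'_def ..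
    also have "Q * cnj Q = of_real ((norm Q)\<^sup>2)" by (rule complex_norm_square[symmetric])
    also have "Re (L * of_real ((norm Q)\<^sup>2)) = Re L * (norm Q)\<^sup>2" by simp
    also have "\<dots> \<ge> 0" using nn[of t] by (simp add: L_def)
    finally show "0 \<le> Re (\<Sum>j\<in>J. a j * exp (\<i> * of_real (l j * t)))" .
  qed
  also have "{j. j \<in> J \<and> l j = 0} = {(n, i, j). n \<in> S \<and> i \<in> I \<and> j \<in> I \<and> n * q j = q i}"
    using l0 by (auto simp: J_def)
  finally show ?thesis unfolding a_def .
qed

lemma dvd_prod_primes_subset:
  fixes A B :: "nat set"
  assumes "finite A" "finite B" "\<And>p. p \<in> A \<union> B \<Longrightarrow> prime p" "\<Prod>B dvd \<Prod>A"
  shows "B \<subseteq> A"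
proof
  fix p assume p: "p \<in> B"
  have "p dvd \<Prod>B" using dvd_prodI[OF assms(2) p, of "\<lambda>x. x"] .
  hence "p dvd \<Prod>A" using assms(4) by (rule dvd_trans)
  then obtain r where "r \<in> A" "p dvd r"
    using prime_dvd_prod_iff[OF assms(1), of p "\<lambda>x. x"] assms(3) p by auto
  moreover from this have "p = r" using assms(3) p primes_dvd_imp_eq by blast
  ultimately show "p \<in> A" by simp
qed

text \<open>
  Use \<open>Q(t) = \<Prod>(1 + e\<^sub>p p\<^sup>i\<^sup>t)\<close>, whose frequencies are the logarithms of the products \<open>\<Prod>A\<close> with
  \<open>A \<subseteq> P\<close>. By unique factorization \<open>n \<Prod>B = \<Prod>A\<close> means that \<open>B \<subseteq> A\<close> and \<open>n = \<Prod>(A - B)\<close>;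
  the sum below runs over \<open>D = A - B\<close>.
\<close>

lemma Re_prod_nonneg_of_Re_sum_nonneg:
  fixes b :: "nat \<Rightarrow> complex"
  assumes P: "finite P" "\<And>p. p \<in> P \<Longrightarrow> prime p" and N: "\<Prod>P \<le> N"
    and e: "\<And>p. p \<in> P \<Longrightarrow> norm (e p) = 1"
    and nn: "\<And>t. 0 \<le> Re (\<Sum>n\<in>{1..N}. b n * exp (- (\<i> * of_real (ln (real n) * t))))"
  shows "0 \<le> Re (\<Sum>A\<in>Pow P. \<Sum>D\<in>Pow A. b (\<Prod>D) * (\<Prod>p\<in>D. e p))"
proof -
  define w where "w = (\<lambda>A. \<Prod>p\<in>A. e p)"
  have fin: "finite A" if "A \<subseteq> P" for A using that P(1) finite_subset by blast
  have pos: "\<Prod>A > 0" if "A \<subseteq> P" for A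
    using that P(2) by (intro prod_pos) (auto dest: prime_gt_0_nat)
  have le: "\<Prod>A \<le> N" if "A \<subseteq> P" for A
  proof -
    have "\<Prod>A dvd \<Prod>P" by (rule prod_dvd_prod_subset[OF P(1) that])
    hence "\<Prod>A \<le> \<Prod>P" using pos[OF order_refl] by (intro dvd_imp_le)
    thus ?thesis using N by simp
  qed
  have split: "\<Prod>(A - D) * \<Prod>D = \<Prod>A" if "A \<subseteq> P" "D \<subseteq> A" for A D
    using prod.subset_diff[OF that(2) fin[OF that(1)], of "\<lambda>x. x"] by simp
  have w: "w A * cnj (w (A - D)) = w D" if "A \<subseteq> P" "D \<subseteq> A" for A D
  proof -
    have "w A = w (A - D) * w D"
      unfolding w_def by (rule prod.subset_diff[OF that(2) fin[OF that(1)]])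
    moreover have "norm (w (A - D)) = 1"
      unfolding w_def prod_norm[symmetric] using e that by (intro prod.neutral) auto
    hence "w (A - D) * cnj (w (A - D)) = 1" by (simp flip: complex_norm_square)
    ultimately show ?thesis by (simp add: mult_ac)
  qed
  let ?T = "{(n, A, B). n \<in> {1..N} \<and> A \<in> Pow P \<and> B \<in> Pow P \<and> n * \<Prod>B = \<Prod>A}"
  have "0 \<le> Re (\<Sum>(n, A, B)\<in>?T. b n * w A * cnj (w B))"
    using P(1) pos nn by (intro Re_toeplitz_nonneg) auto
  also have "(\<Sum>(n, A, B)\<in>?T. b n * w A * cnj (w B)) = (\<Sum>(A, D)\<in>Sigma (Pow P) Pow. b (\<Prod>D) * w D)"
  proof (rule sum.reindex_bij_witness[where i = "\<lambda>(A, D). (\<Prod>D, A, A - D)" and j = "\<lambda>(n, A, B). (A, A - B)"])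
    fix T assume "T \<in> ?T"
    then obtain n A B where T: "T = (n, A, B)" "n \<in> {1..N}" "A \<subseteq> P" "B \<subseteq> P" "n * \<Prod>B = \<Prod>A" by auto
    have "\<Prod>B dvd \<Prod>A" using T(5)[symmetric] by simp
    hence BA: "B \<subseteq> A"
      using dvd_prod_primes_subset[OF fin[OF T(3)] fin[OF T(4)]] T P(2) by auto
    have "\<Prod>(A - B) * \<Prod>B = n * \<Prod>B" using split[OF T(3) BA] T(5) by simp
    hence n: "\<Prod>(A - B) = n" using pos[OF T(4)] by simp
    show "(case case T of (n, A, B) \<Rightarrow> (A, A - B) of (A, D) \<Rightarrow> (\<Prod>D, A, A - D)) = T"
      using T(1) n BA by (simp add: double_diff)
    show "(case T of (n, A, B) \<Rightarrow> (A, A - B)) \<in> Sigma (Pow P) Pow" using T by auto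
    show "(case case T of (n, A, B) \<Rightarrow> (A, A - B) of (A, D) \<Rightarrow> b (\<Prod>D) * w D) = (case T of (n, A, B) \<Rightarrow> b n * w A * cnj (w B))"
      using T(1) n w[OF T(3), of "A - B"] BA by (simp add: double_diff mult.assoc)
  next
    fix x assume "x \<in> Sigma (Pow P) Pow"
    then obtain A D where x: "x = (A, D)" "A \<subseteq> P" "D \<subseteq> A" by auto
    show "(case case x of (A, D) \<Rightarrow> (\<Prod>D, A, A - D) of (n, A, B) \<Rightarrow> (A, A - B)) = x"
      using x by (simp add: double_diff)
    show "(case x of (A, D) \<Rightarrow> (\<Prod>D, A, A - D)) \<in> ?T"
      using x le[of D] pos[of D] split[OF x(2,3)] by (auto simp: mult.commute Suc_le_eq)
  qed
  also have "\<dots> = (\<Sum>A\<in>Pow P. \<Sum>D\<in>Pow A. b (\<Prod>D) * w D)"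
    by (rule sum.Sigma[symmetric]) (use P(1) fin in auto)
  finally show ?thesis unfolding w_def .
qed

lemma dirichlet_character_1:
  assumes "dirichlet_character m chi"
  shows "chi 1 = 1"
proof -
  have mult: "\<forall>a\<ge>1. \<forall>b\<ge>1. chi (a * b) = chi a * chi b"
    and nz: "\<forall>n\<ge>1. coprime n m \<longrightarrow> chi n \<noteq> 0"
    using assms unfolding dirichlet_character_def by blast+
  have "chi 1 = chi 1 * chi 1" using mult[rule_format, of 1 1] by simp
  moreover have "chi 1 \<noteq> 0" using nz by simp
  ultimately show ?thesis by simp
qed

text \<open>By Euler's theorem the value is a root of unity.\<close>

lemma dirichlet_character_norm_eq_1:
  assumes chi: "dirichlet_character m chi" and n: "n \<ge> 1" "coprime n m"
  shows "norm (chi n) = 1"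
proof -
  have m: "m \<ge> 1" and per: "\<And>k. k \<ge> 1 \<Longrightarrow> chi (k + m) = chi k"
    and mult: "\<And>a b. a \<ge> 1 \<Longrightarrow> b \<ge> 1 \<Longrightarrow> chi (a * b) = chi a * chi b"
    using chi by (auto simp: dirichlet_character_def)
  have pow: "chi (n ^ k) = chi n ^ k" for k
    using n(1) dirichlet_character_1[OF chi] by (induction k) (auto simp: mult)
  have per': "chi (1 + k * m) = chi 1" for k
  proof (induction k)
    case (Suc k)
    have "chi (1 + Suc k * m) = chi ((1 + k * m) + m)" by (simp add: algebra_simps)
    also have "\<dots> = chi (1 + k * m)" by (rule per) simp
    finally show ?case using Suc by simp
  qed simp
  have "[n ^ totient m = 1] (mod m)" by (rule euler_theorem[OF n(2)])
  hence "[1 = n ^ totient m] (mod m)" by (rule cong_sym)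
  moreover have "1 \<le> n ^ totient m" using n(1) by (rule one_le_power)
  ultimately obtain k where "n ^ totient m = 1 + k * m"
    using cong_le_nat[of 1 "n ^ totient m" m] by (auto simp: cong_sym_eq mult.commute add.commute)
  hence "chi n ^ totient m = 1"
    using pow[of "totient m"] per'[of k] dirichlet_character_1[OF chi] by simp
  from power_eq_1_iff[OF this] show ?thesis using m by simp
qed

lemma dirichlet_character_norm_le_1:
  assumes "dirichlet_character m chi"
  shows "norm (chi (Suc n)) \<le> 1"
proof (cases "coprime (Suc n) m")
  case True
  thus ?thesis using dirichlet_character_norm_eq_1[OF assms, of "Suc n"] by simp
next
  case False
  thus ?thesis using assms by (simp add: dirichlet_character_def)
qed

lemma dirichlet_character_prod:
  assumes chi: "dirichlet_character m chi" and "finite A" "\<And>p. p \<in> A \<Longrightarrow> p \<ge> 1"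
  shows "chi (\<Prod>A) = (\<Prod>p\<in>A. chi p)"
  using assms(2,3)
proof (induction A rule: finite_induct)
  case (insert p A)
  have "\<Prod>A \<ge> 1" using insert by (intro prod_ge_1) auto
  thus ?case using insert chi by (simp add: dirichlet_character_def)
qed (simp add: dirichlet_character_1[OF chi, unfolded One_nat_def])

text \<open>
  A partial sum of the series has real part at least \<open>- \<delta>\<close>, uniformly in \<open>t\<close>, where \<open>\<delta>\<close> bounds the
  tail. Adding \<open>\<delta>\<close> to the first coefficient makes the previous lemma applicable. The
  resulting double sum of the multiplicative function \<open>chi(n) n\<^sup>-\<^sup>\<sigma>\<close> factors into the product, and the
  extra \<open>\<delta>\<close> contributes only \<open>2\<^bsup>|P|\<^esup> \<delta>\<close>.
\<close>

lemma Re_euler_prod_nonneg: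
  assumes chi: "dirichlet_character m chi"
    and nn: "\<And>s. Re s > 1 \<Longrightarrow> 0 \<le> Re (dirichlet_L chi s)"
    and P: "finite P" "\<And>p. p \<in> P \<Longrightarrow> prime p \<and> \<not> p dvd m"
    and \<sigma>: "\<sigma> > 1"
  shows "0 \<le> Re (\<Prod>p\<in>P. 2 + \<i> * of_real (real p powr (-\<sigma>)))"
proof (rule field_le_epsilon)
  fix \<epsilon> :: real assume \<epsilon>: "\<epsilon> > 0"
  define \<delta> where "\<delta> = \<epsilon> / 2 ^ card P"
  have \<delta>: "\<delta> > 0" using \<epsilon> by (simp add: \<delta>_def)
  note chi_le = dirichlet_character_norm_le_1[OF chi]
  obtain N0 where N0: "\<And>n. n \<ge> N0 \<Longrightarrow> norm (\<Sum>i. real (Suc (i + n)) powr (-\<sigma>)) < \<delta>"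
    using suminf_exist_split[OF \<delta> summable_zeta[OF \<sigma>]] by blast
  define N where "N = max N0 (\<Prod>P)"
  define f where "f = (\<lambda>n. chi n * of_real (real n powr (-\<sigma>)))"
  \<comment> \<open>The coefficients of the partial sum, raised by \<open>\<delta>\<close> to make its real part nonnegative.\<close>
  define b where "b = (\<lambda>n. f n + (if n = 1 then of_real \<delta> else 0))"
  \<comment> \<open>With this phase every factor becomes \<open>2 + i p\<^sup>-\<^sup>\<sigma>\<close>.\<close>
  define e where "e = (\<lambda>p. \<i> * cnj (chi p))"
  have N1: "N \<ge> 1"
  proof -
    have "\<Prod>P \<ge> 1" using P(2) prime_ge_1_nat by (intro prod_ge_1) blast
    thus ?thesis by (simp add: N_def)
  qed
  have cop: "norm (chi p) = 1" if "p \<in> P" for p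
  proof (rule dirichlet_character_norm_eq_1[OF chi])
    show "p \<ge> 1" using P(2)[OF that] prime_ge_1_nat by blast
    show "coprime p m" using P(2)[OF that] prime_imp_coprime by blast
  qed
  have "0 \<le> Re (\<Sum>A\<in>Pow P. \<Sum>D\<in>Pow A. b (\<Prod>D) * (\<Prod>p\<in>D. e p))"
  proof (rule Re_prod_nonneg_of_Re_sum_nonneg[OF P(1), of N])
    show "norm (e p) = 1" if "p \<in> P" for p using cop[OF that] by (simp add: e_def norm_mult)
    fix t :: real
    define s where "s = Complex \<sigma> t"
    have s: "Re s > 1" using \<sigma> by (simp add: s_def)
    define g where "g = (\<lambda>n. chi (Suc n) * of_nat (Suc n) powr (-s))"
    have g: "g n = f (Suc n) * exp (- (\<i> * of_real (ln (real (Suc n)) * t)))" for n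
    proof -
      have "(of_nat (Suc n) powr (-s) :: complex) = exp (-s * of_real (ln (real (Suc n))))"
        using Ln_of_nat[of "Suc n"] by (simp add: powr_def mult.commute del: of_nat_Suc)
      also have "-s * of_real (ln (real (Suc n))) = of_real (- \<sigma> * ln (real (Suc n))) + - (\<i> * of_real (ln (real (Suc n)) * t))"
        by (simp add: complex_eq_iff s_def del: of_nat_Suc)
      also have "exp \<dots> = of_real (real (Suc n) powr (-\<sigma>)) * exp (- (\<i> * of_real (ln (real (Suc n)) * t)))"
        unfolding exp_add exp_of_real powr_def by (simp del: of_nat_Suc)
      finally show ?thesis by (simp add: g_def f_def del: of_nat_Suc)
    qed
    have sm: "summable g" unfolding g_def by (rule summable_dirichlet_series[of chi, OF chi_le s])
    have "dirichlet_L chi s = (\<Sum>n. g (n + N)) + (\<Sum>n<N. g n)"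
      using s suminf_split_initial_segment[OF sm, of N] by (simp add: dirichlet_L_def dirichlet_series_def g_def)
    moreover have "norm (\<Sum>n. g (n + N)) \<le> \<delta>"
    proof -
      have "norm (\<Sum>n. g (n + N)) \<le> (\<Sum>n. real (Suc (n + N)) powr (-\<sigma>))"
      proof (rule norm_suminf_le)
        show "norm (g (n + N)) \<le> real (Suc (n + N)) powr (-\<sigma>)" for n
          unfolding g_def by (rule norm_dirichlet_term_le[of chi, OF chi_le]) (simp add: s_def)
        show "summable (\<lambda>n. real (Suc (n + N)) powr (-\<sigma>))"
          using summable_ignore_initial_segment[OF summable_zeta[OF \<sigma>], of N] .
      qed
      also have "\<dots> \<le> \<delta>" using N0[of N] by (simp add: N_def)
      finally show ?thesis .
    qed
    ultimately have "0 \<le> Re ((\<Sum>n<N. g n) + of_real \<delta>)"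
      using nn[OF s] complex_Re_le_cmod[of "\<Sum>n. g (n + N)"] by simp
    also have "(\<Sum>n<N. g n) + of_real \<delta> = (\<Sum>n\<in>{1..N}. b n * exp (- (\<i> * of_real (ln (real n) * t))))"
    proof -
      let ?E = "\<lambda>n. exp (- (\<i> * of_real (ln (real n) * t)))"
      have "(\<Sum>n\<in>{1..N}. b n * ?E n) = (\<Sum>n\<in>{1..N}. f n * ?E n + (if n = 1 then of_real \<delta> * ?E n else 0))"
        by (intro sum.cong) (auto simp: b_def algebra_simps)
      also have "\<dots> = (\<Sum>n\<in>{1..N}. f n * ?E n) + of_real \<delta>"
        using N1 by (simp add: sum.distrib)
      also have "(\<Sum>n\<in>{1..N}. f n * ?E n) = (\<Sum>n<N. g n)"
        unfolding g by (rule sum.reindex_bij_witness[of _ Suc "\<lambda>n. n - 1"]) auto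
      finally show ?thesis by simp
    qed
    finally show "0 \<le> Re (\<Sum>n\<in>{1..N}. b n * exp (- (\<i> * of_real (ln (real n) * t))))" .
  qed (use P in \<open>auto simp: N_def\<close>)
  also have "(\<Sum>A\<in>Pow P. \<Sum>D\<in>Pow A. b (\<Prod>D) * (\<Prod>p\<in>D. e p))
      = (\<Sum>A\<in>Pow P. (\<Prod>p\<in>A. 1 + \<i> * of_real (real p powr (-\<sigma>))) + of_real \<delta>)"
  proof (rule sum.cong[OF refl])
    fix A assume "A \<in> Pow P"
    hence A: "A \<subseteq> P" "finite A" using P(1) finite_subset by auto
    have "b (\<Prod>D) * (\<Prod>p\<in>D. e p) = (\<Prod>p\<in>D. \<i> * of_real (real p powr (-\<sigma>))) + (if D = {} then of_real \<delta> else 0)"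
      if D: "D \<subseteq> A" for D
    proof -
      have DP: "D \<subseteq> P" "finite D" using D A finite_subset by auto
      have ge2: "p \<ge> 2" if "p \<in> D" for p using that DP P(2) prime_ge_2_nat by auto
      have "\<Prod>D = 1 \<longleftrightarrow> D = {}"
      proof
        assume *: "\<Prod>D = 1"
        show "D = {}"
        proof (rule ccontr)
          assume "D \<noteq> {}"
          then obtain p where p: "p \<in> D" by blast
          have "p dvd \<Prod>D" using dvd_prodI[OF DP(2) p, of "\<lambda>x. x"] by simp
          with * ge2[OF p] show False by simp
        qed
      qed simp
      moreover have "f (\<Prod>D) * (\<Prod>p\<in>D. e p) = (\<Prod>p\<in>D. \<i> * of_real (real p powr (-\<sigma>)))"
      proof -
        have "chi (\<Prod>D) = (\<Prod>p\<in>D. chi p)"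
          using ge2 DP by (intro dirichlet_character_prod[OF chi]) force+
        moreover have "real (\<Prod>D) powr (-\<sigma>) = (\<Prod>p\<in>D. real p powr (-\<sigma>))"
          by (simp add: prod_powr_distrib)
        ultimately have "f (\<Prod>D) * (\<Prod>p\<in>D. e p) = (\<Prod>p\<in>D. chi p * of_real (real p powr (-\<sigma>)) * e p)"
          by (simp add: f_def prod.distrib)
        also have "\<dots> = (\<Prod>p\<in>D. \<i> * of_real (real p powr (-\<sigma>)))"
        proof (rule prod.cong[OF refl])
          fix p assume "p \<in> D"
          hence "chi p * cnj (chi p) = 1" using cop[of p] DP by (auto simp flip: complex_norm_square)
          thus "chi p * of_real (real p powr (-\<sigma>)) * e p = \<i> * of_real (real p powr (-\<sigma>))"
            by (simp add: e_def mult_ac)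
        qed
        finally show ?thesis .
      qed
      ultimately show ?thesis by (simp add: b_def distrib_right)
    qed
    hence "(\<Sum>D\<in>Pow A. b (\<Prod>D) * (\<Prod>p\<in>D. e p))
       = (\<Sum>D\<in>Pow A. (\<Prod>p\<in>D. \<i> * of_real (real p powr (-\<sigma>))) + (if D = {} then of_real \<delta> else 0))"
      by (intro sum.cong) auto
    also have "\<dots> = (\<Sum>D\<in>Pow A. \<Prod>p\<in>D. \<i> * of_real (real p powr (-\<sigma>))) + of_real \<delta>"
      using A(2) by (simp add: sum.distrib)
    also have "(\<Sum>D\<in>Pow A. \<Prod>p\<in>D. \<i> * of_real (real p powr (-\<sigma>))) = (\<Prod>p\<in>A. \<i> * of_real (real p powr (-\<sigma>)) + 1)"
      by (subst prod_add[OF A(2)]) simp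
    finally show "(\<Sum>D\<in>Pow A. b (\<Prod>D) * (\<Prod>p\<in>D. e p)) = (\<Prod>p\<in>A. 1 + \<i> * of_real (real p powr (-\<sigma>))) + of_real \<delta>"
      by (simp add: add.commute)
  qed
  also have "\<dots> = (\<Sum>A\<in>Pow P. \<Prod>p\<in>A. 1 + \<i> * of_real (real p powr (-\<sigma>))) + of_real \<epsilon>"
    using P(1) by (simp add: sum.distrib card_Pow \<delta>_def)
  also have "(\<Sum>A\<in>Pow P. \<Prod>p\<in>A. 1 + \<i> * of_real (real p powr (-\<sigma>)))
      = (\<Prod>p\<in>P. (1 + \<i> * of_real (real p powr (-\<sigma>))) + 1)"
    by (subst prod_add[OF P(1)]) simp
  also have "\<dots> = (\<Prod>p\<in>P. 2 + \<i> * of_real (real p powr (-\<sigma>)))"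
    by (intro prod.cong) auto
  finally show "0 \<le> Re (\<Prod>p\<in>P. 2 + \<i> * of_real (real p powr (-\<sigma>))) + \<epsilon>" by simp
qed

theorem exists_zero_Re_dirichlet_L:
  assumes chi: "dirichlet_character m chi"
  shows "\<exists>s. Re s > 1 \<and> Re (dirichlet_L chi s) = 0"
proof (rule ccontr)
  assume no: "\<not> ?thesis"
  have nn: "0 \<le> Re (dirichlet_L chi s)" if "Re s > 1" for s
    by (rule less_imp_le[OF Re_dirichlet_L_pos[of chi 1, OF dirichlet_character_norm_le_1[OF chi]
            dirichlet_character_1[OF chi] order_refl _ that]]) (use no in blast)
  have m: "m > 0" using chi by (simp add: dirichlet_character_def)
  from exists_primes_Re_prod_neg[OF m] obtain P
    where fin: "finite P" and prime: "\<forall>p\<in>P. prime p \<and> \<not> p dvd m"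
      and neg: "Re (\<Prod>p\<in>P. 2 + \<i> * of_real (1 / real p)) < 0"
    by (elim exE conjE)
  note P = fin prime[rule_format]
  have "((\<lambda>\<sigma>. Re (\<Prod>p\<in>P. 2 + \<i> * of_real (real p powr (-\<sigma>)))) \<longlongrightarrow> Re (\<Prod>p\<in>P. 2 + \<i> * of_real (real p powr (-1)))) (at_right 1)"
    by (intro tendsto_intros) (auto dest: P(2) prime_gt_0_nat)
  moreover have "eventually (\<lambda>\<sigma>. 0 \<le> Re (\<Prod>p\<in>P. 2 + \<i> * of_real (real p powr (-\<sigma>)))) (at_right 1)"
    using eventually_at_right_less[of 1]
    by eventually_elim (rule Re_euler_prod_nonneg[OF chi nn P])
  ultimately have "0 \<le> Re (\<Prod>p\<in>P. 2 + \<i> * of_real (real p powr (-1)))"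
    by (rule tendsto_lowerbound) simp
  also have "(\<Prod>p\<in>P. 2 + \<i> * of_real (real p powr (-1))) = (\<Prod>p\<in>P. 2 + \<i> * of_real (1 / real p) :: complex)"
    by (intro prod.cong) (auto simp: powr_minus_divide)
  finally show False using neg by simp
qed

section \<open>The heat kernel\<close>

lemma borel_measurable_heat_kernel [measurable]: "heat_kernel t \<in> borel_measurable borel"
  unfolding heat_kernel_def by measurable

lemma heat_kernel_nonneg: "0 \<le> heat_kernel t x"
  by (simp add: heat_kernel_def)

lemma heat_kernel_minus: "heat_kernel t (x - y) = heat_kernel t (y - x)"
  by (simp add: heat_kernel_def norm_minus_commute)

lemma heat_kernel_eq_prod_normal_density:
  fixes x :: "real ^ 'd"
  assumes "t > 0"
  shows "heat_kernel t x = (\<Prod>b\<in>Basis. normal_density 0 (sqrt (2 * t)) (x \<bullet> b))"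
proof -
  have nd: "normal_density 0 (sqrt (2 * t)) z = (4 * pi * t) powr (-1/2) * exp (- z\<^sup>2 / (4 * t))" for z
  proof -
    have "2 * pi * (sqrt (2 * t))\<^sup>2 = 4 * pi * t" "2 * (sqrt (2 * t))\<^sup>2 = 4 * t" using assms by auto
    moreover have "(4 * pi * t) powr (-1/2) = 1 / sqrt (4 * pi * t)"
      using assms by (simp only: minus_divide_left[symmetric] powr_minus_divide powr_half_sqrt)
        (simp add: powr_half_sqrt)
    ultimately show ?thesis unfolding normal_density_def by simp
  qed
  have "(\<Prod>b\<in>(Basis :: (real ^ 'd) set). exp (- (x \<bullet> b)\<^sup>2 / (4 * t))) = exp (- (norm x)\<^sup>2 / (4 * t))"
    by (simp add: exp_sum[symmetric] sum_divide_distrib[symmetric] sum_negf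
        power2_norm_eq_inner euclidean_inner[of x x] power2_eq_square[of "x \<bullet> _"])
  moreover have "((4 * pi * t) powr (-1/2)) ^ CARD('d) = (4 * pi * t) powr (- real CARD('d) / 2)"
    using assms by (simp add: powr_realpow[symmetric] powr_powr)
  ultimately show ?thesis
    by (simp add: nd heat_kernel_def prod.distrib)
qed

lemma has_bochner_integral_heat_kernel:
  assumes "t > 0"
  shows "has_bochner_integral lborel (heat_kernel t :: real ^ 'd \<Rightarrow> real) 1"
proof (rule has_bochner_integral_nn_integral)
  have "(\<integral>\<^sup>+x. ennreal (normal_density 0 (sqrt (2 * t)) x) \<partial>lborel) = 1"
    using assms by (subst nn_integral_eq_integral) auto
  moreover have "(\<integral>\<^sup>+(x::real^'d). (\<Prod>b\<in>Basis. ennreal (normal_density 0 (sqrt (2 * t)) (x \<bullet> b))) \<partial>lborel)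
      = (\<Prod>b\<in>(Basis :: (real ^ 'd) set). (\<integral>\<^sup>+x. ennreal (normal_density 0 (sqrt (2 * t)) x) \<partial>lborel))"
    by (rule nn_integral_lborel_prod) auto
  ultimately show "(\<integral>\<^sup>+(x::real^'d). ennreal (heat_kernel t x) \<partial>lborel) = ennreal 1"
    using assms by (simp add: heat_kernel_eq_prod_normal_density prod_ennreal)
qed (auto simp: heat_kernel_nonneg)

lemma
  assumes "t > 0"
  shows integrable_heat_kernel: "integrable lborel (\<lambda>y::real ^ 'd. heat_kernel t (x - y))"
    and integral_heat_kernel: "(LINT y|lborel. heat_kernel t (x - y :: real ^ 'd)) = 1"
proof -
  have "has_bochner_integral (distr lborel borel ((+) (-x))) (heat_kernel t :: real ^ 'd \<Rightarrow> real) 1"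
    unfolding lborel_distr_plus by (rule has_bochner_integral_heat_kernel[OF assms])
  thus "integrable lborel (\<lambda>y::real ^ 'd. heat_kernel t (x - y))"
       "(LINT y|lborel. heat_kernel t (x - y :: real ^ 'd)) = 1"
    unfolding heat_kernel_minus[of t x]
    by (simp_all add: has_bochner_integral_iff integrable_distr_eq integral_distr)
qed

text \<open>
  The Gaussian factor increases with time, so only the normalizing constant decreases. This
  gives the continuity in time of the semigroup without differentiating the kernel.
\<close>

lemma heat_kernel_mono_time:
  fixes x :: "real ^ 'd"
  assumes "0 < s" "s \<le> t"
  shows "(s / t) powr (real CARD('d) / 2) * heat_kernel s x \<le> heat_kernel t x"
proof -
  have "(s / t) powr (real CARD('d) / 2) * (4 * pi * s) powr (- real CARD('d) / 2)
     = (4 * pi * t) powr (- real CARD('d) / 2)"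
  proof -
    have "(s / t) powr q * (4 * pi * s) powr (-q) = (4 * pi * t) powr (-q)" for q
    proof -
      have "(s / t) powr q = (4 * pi * s) powr q / (4 * pi * t) powr q"
        using assms powr_divide[of "4 * pi * s" "4 * pi * t" q] by simp
      thus ?thesis using assms by (simp add: powr_minus_divide)
    qed
    thus ?thesis by simp
  qed
  moreover have "exp (- (norm x)\<^sup>2 / (4 * s)) \<le> exp (- (norm x)\<^sup>2 / (4 * t))"
    using assms by (simp add: frac_le)
  ultimately show ?thesis
    unfolding heat_kernel_def mult.assoc[symmetric] by (simp add: mult_left_mono)
qed

text \<open>
  Completing the square in \<open>y\<close>: as a function of \<open>y\<close>, the product of two heat kernels is again
  a multiple of a heat kernel.
\<close>

lemma heat_kernel_mult:
  fixes x y z :: "real ^ 'd"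
  assumes "s > 0" "t > 0"
  shows "heat_kernel t (x - y) * heat_kernel s (y - z) =
         heat_kernel (t + s) (x - z) *
         heat_kernel (t * s / (t + s)) ((s / (t + s)) *\<^sub>R x + (t / (t + s)) *\<^sub>R z - y)"
proof -
  have ts: "t + s > 0" using assms by simp
  let ?c = "(s / (t + s)) *\<^sub>R x + (t / (t + s)) *\<^sub>R z"
  have "(4 * pi * t) * (4 * pi * s) = (4 * pi * (t + s)) * (4 * pi * (t * s / (t + s)))"
    using ts by (simp add: field_simps)
  hence p: "(4 * pi * t) powr (- real CARD('d) / 2) * (4 * pi * s) powr (- real CARD('d) / 2)
      = (4 * pi * (t + s)) powr (- real CARD('d) / 2) * (4 * pi * (t * s / (t + s))) powr (- real CARD('d) / 2)"
    using assms by (simp only: powr_mult[symmetric])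
  have "(norm (x - y))\<^sup>2 / t + (norm (y - z))\<^sup>2 / s =
        (norm (x - z))\<^sup>2 / (t + s) + (norm (?c - y))\<^sup>2 / (t * s / (t + s))"
  proof -
    define a where "a = x - y"
    define b where "b = y - z"
    have c: "?c - y = (1 / (t + s)) *\<^sub>R (s *\<^sub>R a - t *\<^sub>R b)"
    proof -
      have "(t + s) *\<^sub>R (?c - y) = s *\<^sub>R a - t *\<^sub>R b"
        using ts by (simp add: scaleR_add_right scaleR_diff_right a_def b_def scaleR_add_left)
      thus ?thesis using ts by (metis (no_types, lifting) divide_inverse less_irrefl mult_1 scaleR_one scaleR_scaleR left_inverse)
    qed
    have xz: "x - z = a + b" by (simp add: a_def b_def)
    have n1: "(norm (a + b))\<^sup>2 = a \<bullet> a + 2 * (a \<bullet> b) + b \<bullet> b"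
      by (simp add: power2_norm_eq_inner inner_add inner_commute)
    have n2: "(norm (s *\<^sub>R a - t *\<^sub>R b))\<^sup>2 = s\<^sup>2 * (a \<bullet> a) - 2 * s * t * (a \<bullet> b) + t\<^sup>2 * (b \<bullet> b)"
      unfolding power2_norm_eq_inner
      by (simp add: inner_diff inner_commute power2_eq_square algebra_simps)
    have n3: "(norm (?c - y))\<^sup>2 = (s\<^sup>2 * (a \<bullet> a) - 2 * s * t * (a \<bullet> b) + t\<^sup>2 * (b \<bullet> b)) / (t + s)\<^sup>2"
      unfolding c norm_scaleR power_mult_distrib n2 using ts by (simp add: power_divide)
    have "A / t + B / s = (A + 2 * X + B) / (t + s) + (s\<^sup>2 * A - 2 * s * t * X + t\<^sup>2 * B) / (t + s)\<^sup>2 / (t * s / (t + s))" for A B X :: real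
    proof -
      have "N / (t + s)\<^sup>2 / (t * s / (t + s)) = N / ((t + s) * t * s)" for N
        using ts assms by (simp add: power2_eq_square)
      moreover have "A / t + B / s = (A + 2 * X + B) / (t + s) + (s\<^sup>2 * A - 2 * s * t * X + t\<^sup>2 * B) / ((t + s) * t * s)"
        using ts assms by (simp add: divide_simps) (simp add: power2_eq_square algebra_simps)
      ultimately show ?thesis by simp
    qed
    thus ?thesis
      unfolding n3 xz n1 by (simp add: a_def[symmetric] b_def[symmetric] power2_norm_eq_inner)
  qed
  note square = this
  have quarter: "- A / (4 * q) = - (A / q) / 4" for A q :: real by simp
  have "a + b = c + d \<Longrightarrow> - a / 4 + - b / 4 = - c / 4 + - d / 4" for a b c d :: real by simp
  hence "- (norm (x - y))\<^sup>2 / (4 * t) + - (norm (y - z))\<^sup>2 / (4 * s) =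
        - (norm (x - z))\<^sup>2 / (4 * (t + s)) + - (norm (?c - y))\<^sup>2 / (4 * (t * s / (t + s)))"
    unfolding quarter using square by blast
  hence e: "exp (- (norm (x - y))\<^sup>2 / (4 * t)) * exp (- (norm (y - z))\<^sup>2 / (4 * s)) =
        exp (- (norm (x - z))\<^sup>2 / (4 * (t + s))) * exp (- (norm (?c - y))\<^sup>2 / (4 * (t * s / (t + s))))"
    unfolding exp_add[symmetric] by simp
  have "p1 * e1 * (p2 * e2) = p3 * e3 * (p4 * e4)"
    if "p1 * p2 = p3 * p4" "e1 * e2 = e3 * e4" for p1 p2 p3 p4 e1 e2 e3 e4 :: real
  proof -
    have "p1 * e1 * (p2 * e2) = (p1 * p2) * (e1 * e2)" by (simp only: mult_ac)
    also have "\<dots> = p3 * e3 * (p4 * e4)" unfolding that by (simp only: mult_ac)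
    finally show ?thesis .
  qed
  from this[OF p e] show ?thesis unfolding heat_kernel_def .
qed

lemma integral_heat_kernel_mult:
  fixes x z :: "real ^ 'd"
  assumes "s > 0" "t > 0"
  shows "(LINT y|lborel. heat_kernel t (x - y) * heat_kernel s (y - z)) = heat_kernel (t + s) (x - z)"
  using assms by (simp add: heat_kernel_mult integral_heat_kernel)

section \<open>The heat semigroup on bounded continuous functions\<close>

lemma lborel_integral_reflect:
  fixes f :: "'a::euclidean_space \<Rightarrow> 'b::{banach, second_countable_topology}"
  assumes [measurable]: "f \<in> borel_measurable borel"
  shows "(LINT y|lborel. f y) = (LINT y|lborel. f (x - y))"
proof -
  have "lborel = distr lborel borel (\<lambda>y::'a. x - y)"
    using lborel_affine[of "-1" x] by (simp add: density_1)
  hence "(LINT y|lborel. f y) = (LINT y|distr lborel borel (\<lambda>y. x - y). f y)" by simp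
  also have "\<dots> = (LINT y|lborel. f (x - y))" by (rule integral_distr) auto
  finally show ?thesis .
qed

lemma borel_measurable_bcontfun [measurable]:
  fixes f :: "'a::topological_space \<Rightarrow>\<^sub>C 'b::metric_space"
  shows "apply_bcontfun f \<in> borel_measurable borel"
  by (intro borel_measurable_continuous_onI continuous_on_apply_bcontfun)

lemma integrable_heat_kernel_scaleR:
  fixes f :: "(real ^ 'd) \<Rightarrow>\<^sub>C complex"
  assumes "t > 0"
  shows "integrable lborel (\<lambda>y. heat_kernel t (x - y) *\<^sub>R f y)"
proof (rule Bochner_Integration.integrable_bound)
  show "integrable lborel (\<lambda>y. heat_kernel t (x - y) * norm f)"
    by (intro integrable_mult_left integrable_heat_kernel assms)
qed (auto intro!: AE_I2 mult_left_mono norm_bounded simp: heat_kernel_nonneg)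

lemma heat_semigroup_0: "heat_semigroup 0 f = f"
  by (simp add: heat_semigroup_def fun_eq_iff)

lemma heat_semigroup_eq: "t > 0 \<Longrightarrow> heat_semigroup t f x = (LINT y|lborel. heat_kernel t (x - y) *\<^sub>R f y)"
  by (simp add: heat_semigroup_def)

text \<open>
  Averages stay in a half-plane. The functional \<open>l\<close> will be plus or minus the real or the imaginary
  part.
\<close>

lemma heat_semigroup_ge:
  fixes f :: "(real ^ 'd) \<Rightarrow>\<^sub>C complex"
  assumes "t \<ge> 0" and l: "bounded_linear l" and ge: "\<And>y. a \<le> l (f y)"
  shows "(a::real) \<le> l (heat_semigroup t f x)"
proof (cases "t = 0")
  case False
  hence t: "t > 0" using assms by simp
  interpret l: bounded_linear l by (rule l)
  have "a = (LINT y|lborel. heat_kernel t (x - y) * a)"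
    using integral_heat_kernel[OF t, of x] by simp
  also have "\<dots> \<le> (LINT y|lborel. l (heat_kernel t (x - y) *\<^sub>R f y))"
    by (intro integral_mono integrable_mult_left integrable_heat_kernel t
          integrable_bounded_linear[OF l] integrable_heat_kernel_scaleR)
       (auto simp: l.scaleR intro!: mult_left_mono ge heat_kernel_nonneg)
  also have "\<dots> = l (heat_semigroup t f x)"
    by (simp add: heat_semigroup_eq t integral_bounded_linear[OF l] integrable_heat_kernel_scaleR)
  finally show ?thesis .
qed (use ge in \<open>simp add: heat_semigroup_0\<close>)

lemma norm_heat_semigroup_le:
  fixes f :: "(real ^ 'd) \<Rightarrow>\<^sub>C complex"
  assumes "t \<ge> 0"
  shows "norm (heat_semigroup t f x) \<le> norm f"
proof (cases "t = 0")
  case False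
  hence t: "t > 0" using assms by simp
  have "norm (heat_semigroup t f x) \<le> (LINT y|lborel. heat_kernel t (x - y) * norm f)"
    unfolding heat_semigroup_eq[OF t]
    by (intro Bochner_Integration.integral_norm_bound_integral integrable_mult_left integrable_heat_kernel t
              integrable_heat_kernel_scaleR)
       (auto intro!: mult_left_mono norm_bounded simp: heat_kernel_nonneg)
  also have "\<dots> = norm f" by (simp add: integral_heat_kernel t)
  finally show ?thesis .
qed (simp add: heat_semigroup_0 norm_bounded)

lemma heat_semigroup_add:
  fixes f h :: "(real ^ 'd) \<Rightarrow>\<^sub>C complex"
  assumes "t \<ge> 0"
  shows "heat_semigroup t (\<lambda>y. f y + h y) x = heat_semigroup t f x + heat_semigroup t h x"
  using assms by (cases "t = 0")
    (simp_all add: heat_semigroup_0 heat_semigroup_eq scaleR_add_right Bochner_Integration.integral_add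
      integrable_heat_kernel_scaleR)

lemma heat_semigroup_diff:
  fixes f h :: "(real ^ 'd) \<Rightarrow>\<^sub>C complex"
  assumes "t \<ge> 0"
  shows "heat_semigroup t (\<lambda>y. f y - h y) x = heat_semigroup t f x - heat_semigroup t h x"
  using assms by (cases "t = 0")
    (simp_all add: heat_semigroup_0 heat_semigroup_eq scaleR_diff_right Bochner_Integration.integral_diff
      integrable_heat_kernel_scaleR)

lemma heat_semigroup_scaleR:
  fixes f :: "(real ^ 'd) \<Rightarrow>\<^sub>C complex"
  shows "heat_semigroup t (\<lambda>y. c *\<^sub>R f y) x = c *\<^sub>R heat_semigroup t f x"
  by (simp add: heat_semigroup_def scaleR_left_commute[of _ c] del: scaleR_scaleR)

lemma continuous_on_heat_semigroup:
  fixes f :: "(real ^ 'd) \<Rightarrow>\<^sub>C complex"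
  assumes "t \<ge> 0"
  shows "continuous_on UNIV (heat_semigroup t f)"
proof (cases "t = 0")
  case False
  hence t: "t > 0" using assms by simp
  have eq: "heat_semigroup t f x = (LINT y|lborel. heat_kernel t y *\<^sub>R f (x - y))" for x
    unfolding heat_semigroup_eq[OF t] by (subst lborel_integral_reflect[where x = x]) auto
  have "(\<lambda>n. LINT y|lborel. heat_kernel t y *\<^sub>R f (X n - y)) \<longlonglongrightarrow> (LINT y|lborel. heat_kernel t y *\<^sub>R f (x - y))"
    if "X \<longlonglongrightarrow> x" for X x
  proof (rule integral_dominated_convergence[where w = "\<lambda>y. heat_kernel t y * norm f"])
    show "integrable lborel (\<lambda>y::real^'d. heat_kernel t y * norm f)"
      using has_bochner_integral_heat_kernel[OF t]
      by (intro integrable_mult_left) (auto simp: has_bochner_integral_iff)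
    have "(\<lambda>n. f (X n - y)) \<longlonglongrightarrow> f (x - y)" for y
      by (rule continuous_on_tendsto_compose[OF continuous_on_apply_bcontfun[of UNIV f]])
         (use that in \<open>auto intro!: tendsto_intros\<close>)
    thus "AE y in lborel. (\<lambda>n. heat_kernel t y *\<^sub>R f (X n - y)) \<longlonglongrightarrow> heat_kernel t y *\<^sub>R f (x - y)"
      by (intro AE_I2 tendsto_scaleR tendsto_const)
  qed (auto intro!: AE_I2 mult_left_mono norm_bounded simp: heat_kernel_nonneg)
  thus ?thesis
    by (auto simp: continuous_on_sequentially eq o_def)
qed (simp add: heat_semigroup_0)

text \<open>The semigroup as an operator on the space of bounded continuous functions.\<close>
definition heat :: "real \<Rightarrow> ((real ^ 'd) \<Rightarrow>\<^sub>C complex) \<Rightarrow> ((real ^ 'd) \<Rightarrow>\<^sub>C complex)" where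
  "heat t f = Bcontfun (heat_semigroup t f)"

lemma apply_heat:
  assumes "t \<ge> 0"
  shows "apply_bcontfun (heat t f) = heat_semigroup t f"
  unfolding heat_def
  by (rule Bcontfun_inverse, rule bcontfun_normI[OF continuous_on_heat_semigroup norm_heat_semigroup_le])
     (use assms in auto)

lemma heat_0 [simp]: "heat 0 f = f"
  by (rule bcontfun_eqI) (simp add: apply_heat heat_semigroup_0)

lemma norm_heat_le: "t \<ge> 0 \<Longrightarrow> norm (heat t f) \<le> norm f"
  by (rule norm_bound) (simp add: apply_heat norm_heat_semigroup_le)

lemma heat_diff: "t \<ge> 0 \<Longrightarrow> heat t (f - h) = heat t f - heat t h"
  by (rule bcontfun_eqI) (simp add: apply_heat minus_bcontfun.rep_eq heat_semigroup_diff[symmetric])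

lemma heat_add: "t \<ge> 0 \<Longrightarrow> heat t (f + h) = heat t f + heat t h"
  by (rule bcontfun_eqI) (simp add: apply_heat plus_bcontfun.rep_eq heat_semigroup_add[symmetric])

lemma heat_scaleR: "t \<ge> 0 \<Longrightarrow> heat t (c *\<^sub>R f) = c *\<^sub>R heat t f"
  by (rule bcontfun_eqI) (simp add: apply_heat scaleR_bcontfun.rep_eq heat_semigroup_scaleR[symmetric])

lemma dist_heat_le: "t \<ge> 0 \<Longrightarrow> dist (heat t f) (heat t h) \<le> dist f h"
  by (metis dist_norm heat_diff norm_heat_le)

text \<open>
  With \<open>r = (s/t)\<^bsup>d/2\<^esup>\<close> the kernels satisfy \<open>H\<^sub>t \<ge> r H\<^sub>s\<close>, so \<open>|H\<^sub>t - H\<^sub>s| \<le> (H\<^sub>t - r H\<^sub>s) + (1 - r) H\<^sub>s\<close>,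
  and both terms have integral \<open>1 - r\<close>.
\<close>

lemma dist_heat_time_le:
  fixes f :: "(real ^ 'd) \<Rightarrow>\<^sub>C complex"
  assumes "0 < s" "s \<le> t"
  shows "dist (heat t f) (heat s f) \<le> 2 * (1 - (s / t) powr (real CARD('d) / 2)) * norm f"
proof (rule dist_bound)
  fix x :: "real ^ 'd"
  \<comment> \<open>The ratio of the two normalizing constants.\<close>
  define r where "r = (s / t) powr (real CARD('d) / 2)"
  have t: "t > 0" using assms by simp
  have r: "r \<le> 1" unfolding r_def using assms by (intro powr_le1) auto
  have le: "\<bar>heat_kernel t z - heat_kernel s z\<bar>
          \<le> heat_kernel t z - r * heat_kernel s z + (1 - r) * heat_kernel s z" for z :: "real ^ 'd"
  proof -
    have "r * heat_kernel s z \<le> heat_kernel t z" "r * heat_kernel s z \<le> heat_kernel s z"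
      using heat_kernel_mono_time[OF assms, of z] mult_right_mono[OF r heat_kernel_nonneg, of s z]
      by (auto simp: r_def)
    thus ?thesis by (simp add: algebra_simps abs_le_iff)
  qed
  let ?b = "\<lambda>y. heat_kernel t (x - y) - r * heat_kernel s (x - y) + (1 - r) * heat_kernel s (x - y)"
  note int = integrable_heat_kernel[OF t, of x] integrable_heat_kernel[OF assms(1), of x]
  have "heat_semigroup t f x - heat_semigroup s f x
     = (LINT y|lborel. (heat_kernel t (x - y) - heat_kernel s (x - y)) *\<^sub>R f y)"
    using assms t by (simp add: heat_semigroup_eq scaleR_diff_left Bochner_Integration.integral_diff
      integrable_heat_kernel_scaleR)
  also have "norm \<dots> \<le> (LINT y|lborel. ?b y * norm f)"
  proof (rule Bochner_Integration.integral_norm_bound_integral)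
    show "integrable lborel (\<lambda>y. (heat_kernel t (x - y) - heat_kernel s (x - y)) *\<^sub>R f y)"
      using assms t by (simp add: scaleR_diff_left integrable_heat_kernel_scaleR)
    show "integrable lborel (\<lambda>y. ?b y * norm f)" using int by auto
    show "norm ((heat_kernel t (x - y) - heat_kernel s (x - y)) *\<^sub>R f y) \<le> ?b y * norm f" for y
      unfolding norm_scaleR real_norm_def
      by (intro mult_mono le norm_bounded order.trans[OF abs_ge_zero le]) auto
  qed
  also have "\<dots> = 2 * (1 - r) * norm f"
    using int by (simp add: integral_heat_kernel assms t)
  finally show "dist (heat t f x) (heat s f x) \<le> 2 * (1 - (s / t) powr (real CARD('d) / 2)) * norm f"
    using assms t by (simp add: apply_heat dist_norm r_def)
qed

lemma tendsto_heat:
  fixes \<phi> :: "'b \<Rightarrow> (real ^ 'd) \<Rightarrow>\<^sub>C complex"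
  assumes T: "(T \<longlongrightarrow> t0) F" "t0 > 0" and \<phi>: "(\<phi> \<longlongrightarrow> f) F"
  shows "((\<lambda>s. heat (T s) (\<phi> s)) \<longlongrightarrow> heat t0 f) F"
proof -
  let ?b = "\<lambda>s. 2 * (1 - (min (T s) t0 / max (T s) t0) powr (real CARD('d) / 2)) * norm f + dist (\<phi> s) f"
  have pos: "eventually (\<lambda>s. T s > 0) F" using T by (rule order_tendstoD)
  have "(?b \<longlongrightarrow> 2 * (1 - (min t0 t0 / max t0 t0) powr (real CARD('d) / 2)) * norm f + dist f f) F"
    using T by (intro tendsto_intros \<phi>) auto
  hence b0: "(?b \<longlongrightarrow> 0) F" using T(2) by simp
  have "eventually (\<lambda>s. dist (heat (T s) (\<phi> s)) (heat t0 f) \<le> ?b s) F"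
    using pos
  proof eventually_elim
    case (elim s)
    have "dist (heat (T s) f) (heat t0 f) \<le> 2 * (1 - (min (T s) t0 / max (T s) t0) powr (real CARD('d) / 2)) * norm f"
      using dist_heat_time_le[of "T s" t0 f] dist_heat_time_le[of t0 "T s" f] elim T(2)
      by (cases "T s \<le> t0") (simp_all add: dist_commute)
    moreover have "dist (heat (T s) (\<phi> s)) (heat (T s) f) \<le> dist (\<phi> s) f"
      using elim by (intro dist_heat_le) auto
    ultimately show ?case
      using dist_triangle[of "heat (T s) (\<phi> s)" "heat t0 f" "heat (T s) f"] by linarith
  qed
  thus ?thesis
    unfolding tendsto_dist_iff[of _ "heat t0 f"]
    by (intro tendsto_sandwich[OF _ _ tendsto_const b0]) auto
qed

lemma continuous_on_heat:
  assumes "continuous_on A T" "continuous_on A \<phi>" "\<And>s. s \<in> A \<Longrightarrow> T s > 0"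
  shows "continuous_on A (\<lambda>s. heat (T s) (\<phi> s))"
  using assms unfolding continuous_on_def by (auto intro: tendsto_heat)

text \<open>Fubini's theorem reduces the semigroup law to the convolution of two heat kernels.\<close>

lemma heat_heat:
  fixes f :: "(real ^ 'd) \<Rightarrow>\<^sub>C complex"
  assumes "s \<ge> 0" "t \<ge> 0"
  shows "heat t (heat s f) = heat (t + s) f"
proof (cases "s = 0 \<or> t = 0")
  case False
  hence st: "s > 0" "t > 0" using assms by auto
  show ?thesis
  proof (rule bcontfun_eqI)
    fix x :: "real ^ 'd"
    let ?h = "\<lambda>y z. (heat_kernel t (x - y) * heat_kernel s (y - z)) *\<^sub>R f z"
    have nh: "norm (?h y z) \<le> heat_kernel t (x - y) * (heat_kernel s (y - z) * norm f)" for y z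
      by (simp add: abs_mult heat_kernel_nonneg mult_left_mono norm_bounded mult.assoc)
    have int: "integrable (lborel \<Otimes>\<^sub>M lborel) (case_prod ?h)"
    proof (rule lborel_pair.Fubini_integrable)
      show "case_prod ?h \<in> borel_measurable (lborel \<Otimes>\<^sub>M lborel)"
        by measurable
      have i1: "integrable lborel (\<lambda>z. ?h y z)" for y
        using integrable_scaleR_right[OF integrable_heat_kernel_scaleR[OF st(1), of y f], of "heat_kernel t (x - y)"]
        by simp
      thus "AE y in lborel. integrable lborel (\<lambda>z. case (y, z) of (y, z) \<Rightarrow> ?h y z)" by simp
      show "integrable lborel (\<lambda>y. LINT z|lborel. norm (case (y, z) of (y, z) \<Rightarrow> ?h y z))"
      proof (rule Bochner_Integration.integrable_bound)
        show "integrable lborel (\<lambda>y. heat_kernel t (x - y) * norm f)"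
          by (intro integrable_mult_left integrable_heat_kernel st)
        have "(LINT z|lborel. norm (?h y z)) \<le> (LINT z|lborel. heat_kernel t (x - y) * (heat_kernel s (y - z) * norm f))" for y
          by (intro integral_mono integrable_mult_left integrable_mult_right integrable_heat_kernel st nh
              integrable_norm i1)
        also have "(LINT z|lborel. heat_kernel t (x - y) * (heat_kernel s (y - z) * norm f)) = heat_kernel t (x - y) * norm f" for y
          by (simp add: integral_heat_kernel st)
        finally show "AE y in lborel. norm (LINT z|lborel. norm (case (y, z) of (y, z) \<Rightarrow> ?h y z)) \<le> norm (heat_kernel t (x - y) * norm f)"
          by (auto simp: heat_kernel_nonneg)
      qed measurable
    qed
    have "heat t (heat s f) x = (LINT y|lborel. LINT z|lborel. ?h y z)"
      using st by (simp add: apply_heat heat_semigroup_eq flip: integral_scaleR_right)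
    also have "\<dots> = (LINT z|lborel. LINT y|lborel. ?h y z)"
      by (rule lborel_pair.Fubini_integral[OF int, symmetric])
    also have "\<dots> = (LINT z|lborel. (LINT y|lborel. heat_kernel t (x - y) * heat_kernel s (y - z)) *\<^sub>R f z)"
    proof (rule Bochner_Integration.integral_cong[OF refl])
      fix z
      have "integrable lborel (\<lambda>y. heat_kernel t (x - y) * heat_kernel s (y - z))"
        using st by (simp add: heat_kernel_mult integrable_heat_kernel)
      thus "(LINT y|lborel. ?h y z) = (LINT y|lborel. heat_kernel t (x - y) * heat_kernel s (y - z)) *\<^sub>R f z"
        by (intro integral_scaleR_left) auto
    qed
    also have "\<dots> = heat (t + s) f x"
      using st by (simp add: integral_heat_kernel_mult apply_heat heat_semigroup_eq)
    finally show "heat t (heat s f) x = heat (t + s) f x" .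
  qed
qed (use assms in auto)

section \<open>The Duhamel integral\<close>

lemma set_integrable_continuous_on_interior:
  fixes f :: "real \<Rightarrow> 'b::{banach, second_countable_topology}"
  assumes cont: "continuous_on {a<..<b} f" and le: "\<And>s. s \<in> {a<..<b} \<Longrightarrow> norm (f s) \<le> M"
  shows "set_integrable lborel {a..b} f"
proof -
  have "set_integrable lborel {a<..<b} f"
    unfolding set_integrable_def
  proof (rule Bochner_Integration.integrable_bound)
    show "integrable lborel (\<lambda>s. indicator {a<..<b} s * M)"
      by (cases "a \<le> b") (auto intro!: integrable_mult_left)
    have "(\<lambda>s. indicator {a<..<b} s *\<^sub>R f s) \<in> borel_measurable borel"
      by (intro borel_measurable_continuous_on_indicator cont) auto
    thus "(\<lambda>s. indicator {a<..<b} s *\<^sub>R f s) \<in> borel_measurable lborel" by simp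
  qed (auto simp: indicator_def intro!: AE_I2 order.trans[OF le])
  also have "?this \<longleftrightarrow> ?thesis"
    by (rule set_integrable_discrete_difference[of "{a, b}"]) auto
  finally show ?thesis .
qed

lemma norm_set_integral_le:
  fixes f :: "real \<Rightarrow> complex"
  assumes "set_integrable lborel {a..b} f" "set_integrable lborel {a..b} h"
    and "\<And>s. s \<in> {a..b} \<Longrightarrow> norm (f s) \<le> h s"
  shows "norm (LINT s:{a..b}|lborel. f s) \<le> (LINT s:{a..b}|lborel. h s)"
  unfolding set_lebesgue_integral_def
  by (rule Bochner_Integration.integral_norm_bound_integral)
     (use assms in \<open>auto simp: set_integrable_def indicator_def\<close>)

lemma set_integral_ge:
  fixes f :: "real \<Rightarrow> complex"
  assumes f: "set_integrable lborel {a..b} f" and l: "bounded_linear l" and "a \<le> b"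
    and ge: "\<And>s. s \<in> {a..b} \<Longrightarrow> (c::real) \<le> l (f s)"
  shows "c * (b - a) \<le> l (LINT s:{a..b}|lborel. f s)"
proof -
  interpret l: bounded_linear l by (rule l)
  have i: "integrable lborel (\<lambda>s. indicator {a..b} s *\<^sub>R c)"
    by (rule integrable_scaleR_left) (use \<open>a \<le> b\<close> in auto)
  have "c * (b - a) = (LINT s|lborel. indicator {a..b} s *\<^sub>R c)"
    using \<open>a \<le> b\<close> by simp
  also have "\<dots> \<le> (LINT s|lborel. l (indicator {a..b} s *\<^sub>R f s))"
    using f by (intro integral_mono integrable_bounded_linear[OF l] i)
      (auto simp: set_integrable_def indicator_def l.zero intro!: ge)
  also have "\<dots> = l (LINT s:{a..b}|lborel. f s)"
    unfolding set_lebesgue_integral_def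
    by (rule integral_bounded_linear[OF l]) (use f in \<open>simp add: set_integrable_def\<close>)
  finally show ?thesis .
qed

lemma continuous_on_bcontfun_apply:
  fixes \<psi> :: "'a::topological_space \<Rightarrow> 'c::topological_space \<Rightarrow>\<^sub>C 'b::metric_space"
  assumes "continuous_on A \<psi>"
  shows "continuous_on (A \<times> UNIV) (\<lambda>p. \<psi> (fst p) (snd p))"
  unfolding continuous_on_def
proof
  fix p :: "'a \<times> 'c" assume p: "p \<in> A \<times> UNIV"
  let ?F = "at p within A \<times> UNIV"
  have "continuous_on (A \<times> (UNIV :: 'c set)) (\<lambda>q. \<psi> (fst q))"
    by (rule continuous_on_compose2[OF assms]) (auto intro!: continuous_intros)
  hence "((\<lambda>q. \<psi> (fst q)) \<longlongrightarrow> \<psi> (fst p)) ?F"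
    using p unfolding continuous_on_def by blast
  hence 1: "((\<lambda>q. dist (\<psi> (fst q)) (\<psi> (fst p))) \<longlongrightarrow> 0) ?F" by (simp add: tendsto_dist_iff[symmetric])
  have "((\<lambda>q. \<psi> (fst p) (snd q)) \<longlongrightarrow> \<psi> (fst p) (snd p)) ?F"
    by (rule continuous_on_tendsto_compose[OF continuous_on_apply_bcontfun[of UNIV]])
       (auto intro!: tendsto_intros)
  hence 2: "((\<lambda>q. dist (\<psi> (fst p) (snd q)) (\<psi> (fst p) (snd p))) \<longlongrightarrow> 0) ?F" by (simp add: tendsto_dist_iff[symmetric])
  have le: "norm (dist (\<psi> (fst q) (snd q)) (\<psi> (fst p) (snd p)))
      \<le> dist (\<psi> (fst q)) (\<psi> (fst p)) + dist (\<psi> (fst p) (snd q)) (\<psi> (fst p) (snd p))" for q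
    unfolding real_norm_def abs_of_nonneg[OF zero_le_dist]
    by (rule order.trans[OF dist_triangle add_right_mono[OF dist_bounded]])
  have "((\<lambda>q. dist (\<psi> (fst q)) (\<psi> (fst p)) + dist (\<psi> (fst p) (snd q)) (\<psi> (fst p) (snd p))) \<longlongrightarrow> 0) ?F"
    using tendsto_add[OF 1 2] by simp
  hence "((\<lambda>q. dist (\<psi> (fst q) (snd q)) (\<psi> (fst p) (snd p))) \<longlongrightarrow> 0) ?F"
    by (rule Lim_null_comparison[OF always_eventually[OF allI[OF le]]])
  thus "((\<lambda>q. \<psi> (fst q) (snd q)) \<longlongrightarrow> \<psi> (fst p) (snd p)) ?F"
    by (rule tendsto_dist_iff[THEN iffD2])
qed

text \<open>
  The integral is taken pointwise in \<open>x\<close>, because the space of bounded continuous functions is not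
  separable and thus no target for the Bochner integral.
\<close>
definition duhamel :: "(real \<Rightarrow> (real ^ 'd) \<Rightarrow>\<^sub>C complex) \<Rightarrow> real \<Rightarrow> ((real ^ 'd) \<Rightarrow>\<^sub>C complex)" where
  "duhamel \<phi> t = Bcontfun (\<lambda>x. LINT s:{0..t}|lborel. heat (t - s) (\<phi> s) x)"

text \<open>
  A single time is a null set. The source belonging to a solution may jump at time \<open>0\<close>, and this
  lemma lets its value there be replaced by a convenient one.
\<close>

lemma duhamel_cong:
  assumes "\<And>s. s > 0 \<Longrightarrow> \<phi> s = \<psi> s"
  shows "duhamel \<phi> t = duhamel \<psi> t"
proof -
  have "(LINT s:{0..t}|lborel. heat (t - s) (\<phi> s) x) = (LINT s:{0..t}|lborel. heat (t - s) (\<psi> s) x)" for x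
    unfolding set_lebesgue_integral_def
    by (rule integral_discrete_difference[of "{0}"]) (use assms in \<open>auto simp: indicator_def\<close>)
  thus ?thesis by (simp add: duhamel_def)
qed

locale duhamel_source =
  fixes \<phi> :: "real \<Rightarrow> (real ^ 'd) \<Rightarrow>\<^sub>C complex" and M :: real
  assumes cont: "continuous_on {0<..} \<phi>" and bound: "\<And>s. norm (\<phi> s) \<le> M"
begin

lemma M_nonneg: "M \<ge> 0"
  by (rule order.trans[OF norm_ge_zero bound])

lemma norm_heat_apply_le: "s \<le> t \<Longrightarrow> norm (heat (t - s) (\<phi> s) x) \<le> M"
  by (rule order.trans[OF norm_bounded order.trans[OF norm_heat_le bound]]) auto

lemma continuous_on_integrand:
  "continuous_on {0<..<t} (\<lambda>s. heat (t - s) (\<phi> s))"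
  by (intro continuous_on_heat continuous_intros continuous_on_subset[OF cont]) auto

lemma continuous_on_integrand_apply:
  "continuous_on {0<..<t} (\<lambda>s. heat (t - s) (\<phi> s) x)"
proof -
  have "continuous_on {0<..<t} (\<lambda>s. (s, x))" by (intro continuous_intros)
  hence "continuous_on {0<..<t} (\<lambda>s. (\<lambda>p. heat (t - fst p) (\<phi> (fst p)) (snd p)) (s, x))"
    by (rule continuous_on_compose2[OF continuous_on_bcontfun_apply[OF continuous_on_integrand], where f = "\<lambda>s. (s, x)"]) auto
  thus ?thesis by simp
qed

lemma set_integrable_integrand:
  assumes "a \<le> b" "0 \<le> a" "b \<le> t"
  shows "set_integrable lborel {a..b} (\<lambda>s. heat (t - s) (\<phi> s) x)"
proof (rule set_integrable_continuous_on_interior[where M = M])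
  show "continuous_on {a<..<b} (\<lambda>s. heat (t - s) (\<phi> s) x)"
    by (rule continuous_on_subset[OF continuous_on_integrand_apply[of t]]) (use assms in auto)
  show "norm (heat (t - s) (\<phi> s) x) \<le> M" if "s \<in> {a<..<b}" for s
    using that assms by (intro norm_heat_apply_le) auto
qed

lemma norm_integral_integrand_le:
  assumes "a \<le> b" "0 \<le> a" "b \<le> t"
  shows "norm (LINT s:{a..b}|lborel. heat (t - s) (\<phi> s) x) \<le> M * (b - a)"
proof -
  have "norm (LINT s:{a..b}|lborel. heat (t - s) (\<phi> s) x) \<le> (LINT s:{a..b}|lborel. M)"
  proof (rule norm_set_integral_le[OF set_integrable_integrand[OF assms]])
    show "set_integrable lborel {a..b} (\<lambda>s. M)"
      unfolding set_integrable_def by (rule integrable_scaleR_left) (use assms in auto)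
  qed (use assms in \<open>auto intro!: norm_heat_apply_le\<close>)
  thus ?thesis using assms by (simp add: set_lebesgue_integral_def mult.commute)
qed

lemma continuous_on_integral_integrand:
  assumes "t \<ge> 0"
  shows "continuous_on UNIV (\<lambda>x. LINT s:{0..t}|lborel. heat (t - s) (\<phi> s) x)"
  unfolding continuous_on_sequentially o_def
proof safe
  fix X x assume X: "X \<longlonglongrightarrow> (x :: real ^ 'd)"
  show "(\<lambda>n. LINT s:{0..t}|lborel. heat (t - s) (\<phi> s) (X n)) \<longlonglongrightarrow> (LINT s:{0..t}|lborel. heat (t - s) (\<phi> s) x)"
    unfolding set_lebesgue_integral_def
  proof (rule integral_dominated_convergence[where w = "\<lambda>s. indicator {0..t} s * M"])
    show "integrable lborel (\<lambda>s. indicator {0..t} s * M)"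
      using assms by (intro integrable_mult_left) auto
    have "(\<lambda>n. heat (t - s) (\<phi> s) (X n)) \<longlonglongrightarrow> heat (t - s) (\<phi> s) x" for s
      by (rule continuous_on_tendsto_compose[OF continuous_on_apply_bcontfun[of UNIV] X]) auto
    thus "AE s in lborel. (\<lambda>n. indicator {0..t} s *\<^sub>R heat (t - s) (\<phi> s) (X n)) \<longlonglongrightarrow> indicator {0..t} s *\<^sub>R heat (t - s) (\<phi> s) x"
      by (intro AE_I2 tendsto_scaleR tendsto_const)
    have meas: "(\<lambda>s. indicator {0..t} s *\<^sub>R heat (t - s) (\<phi> s) y) \<in> borel_measurable lborel" for y
      using set_integrable_integrand[of 0 t t y] assms
      unfolding set_integrable_def by (intro borel_measurable_integrable) simp
    show "(\<lambda>s. indicator {0..t} s *\<^sub>R heat (t - s) (\<phi> s) x) \<in> borel_measurable lborel"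
      "(\<lambda>s. indicator {0..t} s *\<^sub>R heat (t - s) (\<phi> s) (X n)) \<in> borel_measurable lborel" for n
      by (rule meas)+
    show "AE s in lborel. norm (indicator {0..t} s *\<^sub>R heat (t - s) (\<phi> s) (X n)) \<le> indicator {0..t} s * M" for n
      by (intro AE_I2) (simp add: indicator_def norm_heat_apply_le)
  qed
qed

lemma apply_duhamel:
  assumes "t \<ge> 0"
  shows "duhamel \<phi> t x = (LINT s:{0..t}|lborel. heat (t - s) (\<phi> s) x)"
  unfolding duhamel_def
  by (subst Bcontfun_inverse)
     (use bcontfun_normI[OF continuous_on_integral_integrand norm_integral_integrand_le] assms in auto)

lemma norm_duhamel_le: "t \<ge> 0 \<Longrightarrow> norm (duhamel \<phi> t) \<le> M * t"
  using norm_integral_integrand_le[of 0 t t] by (intro norm_bound) (simp add: apply_duhamel)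

text \<open>
  The semigroup commutes with the time integral by Fubini's theorem. The joint measurability
  comes from continuity on the open strip \<open>0 < s < a\<close>.
\<close>

lemma heat_duhamel:
  assumes "0 \<le> a" "a \<le> t"
  shows "heat (t - a) (duhamel \<phi> a) x = (LINT s:{0..a}|lborel. heat (t - s) (\<phi> s) x)"
proof (cases "a = t \<or> a = 0")
  case True
  thus ?thesis
  proof (elim disjE)
    assume "a = 0"
    have "duhamel \<phi> 0 = 0" using norm_duhamel_le[of 0] by simp
    moreover have "(LINT s:{0..0}|lborel. heat (t - s) (\<phi> s) x) = 0"
      using norm_integral_integrand_le[of 0 0 t x] assms by simp
    moreover have "heat t (0 :: (real ^ 'd) \<Rightarrow>\<^sub>C complex) = 0"
      using norm_heat_le[of t "0 :: (real ^ 'd) \<Rightarrow>\<^sub>C complex"] assms by (metis norm_zero norm_le_zero_iff order.trans)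
    ultimately show ?thesis unfolding \<open>a = 0\<close> diff_zero by (metis zero_bcontfun.rep_eq)
  qed (use assms in \<open>simp add: apply_duhamel\<close>)
next
  case False
  hence a: "0 < a" "a < t" using assms by auto
  let ?f = "\<lambda>s y. heat_kernel (t - a) (x - y) *\<^sub>R (indicator {0<..<a} s *\<^sub>R heat (a - s) (\<phi> s) y)"
  \<comment> \<open>The integrand is known to be continuous on the open interval only, and the end points are null.\<close>
  have ndd: "(LINT s:{0..b}|lborel. k s) = (LINT s|lborel. indicator {0<..<b} s *\<^sub>R k s)" for b and k :: "real \<Rightarrow> complex"
    unfolding set_lebesgue_integral_def
    by (rule integral_discrete_difference[of "{0, b}"]) (auto simp: indicator_def)
  have int: "integrable (lborel \<Otimes>\<^sub>M lborel) (case_prod ?f)"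
  proof (rule lborel_pair.Fubini_integrable)
    have "(\<lambda>p. indicator ({0<..<a} \<times> UNIV) p *\<^sub>R heat (a - fst p) (\<phi> (fst p)) (snd p)) \<in> borel_measurable borel"
      by (intro borel_measurable_continuous_on_indicator
           continuous_on_bcontfun_apply[OF continuous_on_integrand]) (auto simp: borel_prod[symmetric])
    hence "(\<lambda>p. indicator ({0<..<a} \<times> UNIV) p *\<^sub>R heat (a - fst p) (\<phi> (fst p)) (snd p))
        \<in> borel_measurable (lborel \<Otimes>\<^sub>M lborel)"
      unfolding lborel_prod measurable_lborel2 .
    moreover have "(\<lambda>(s, y). heat_kernel (t - a) (x - y)) \<in> borel_measurable (lborel \<Otimes>\<^sub>M lborel)"
      by measurable
    ultimately have "(\<lambda>p. (case p of (s, y) \<Rightarrow> heat_kernel (t - a) (x - y)) *\<^sub>R (indicator ({0<..<a} \<times> UNIV) p *\<^sub>R heat (a - fst p) (\<phi> (fst p)) (snd p)))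
       \<in> borel_measurable (lborel \<Otimes>\<^sub>M lborel)"
      by (rule borel_measurable_scaleR[rotated])
    also have "(\<lambda>p. (case p of (s, y) \<Rightarrow> heat_kernel (t - a) (x - y)) *\<^sub>R (indicator ({0<..<a} \<times> UNIV) p *\<^sub>R heat (a - fst p) (\<phi> (fst p)) (snd p))) = case_prod ?f"
      by (auto simp: fun_eq_iff indicator_def)
    finally show "case_prod ?f \<in> borel_measurable (lborel \<Otimes>\<^sub>M lborel)" .
    have i: "integrable lborel (\<lambda>y. heat_kernel (t - a) (x - y) *\<^sub>R heat (a - s) (\<phi> s) y)" for s
      using a by (intro integrable_heat_kernel_scaleR) auto
    hence i': "integrable lborel (?f s)" for s
      using integrable_scaleR_right[OF i, of "indicator {0<..<a} s" s] by (simp add: mult.commute)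
    thus "AE s in lborel. integrable lborel (\<lambda>y. case (s, y) of (s, y) \<Rightarrow> ?f s y)"
      by simp
    show "integrable lborel (\<lambda>s. LINT y|lborel. norm (case (s, y) of (s, y) \<Rightarrow> ?f s y))"
    proof (rule Bochner_Integration.integrable_bound)
      show "integrable lborel (\<lambda>s. indicator {0<..<a} s * M)"
        using a by (intro integrable_mult_left) auto
      have meas: "case_prod ?f \<in> borel_measurable (lborel \<Otimes>\<^sub>M lborel)" by fact
      show "(\<lambda>s. LINT y|lborel. norm (case (s, y) of (s, y) \<Rightarrow> ?f s y)) \<in> borel_measurable lborel"
        using measurable_compose[OF meas borel_measurable_norm]
        by (intro sigma_finite_measure.borel_measurable_lebesgue_integral[OF sigma_finite_lborel])
           (simp only: split_def fst_conv snd_conv)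
      have "(LINT y|lborel. norm (?f s y)) \<le> indicator {0<..<a} s * M" for s
      proof -
        have "(LINT y|lborel. norm (?f s y)) \<le> (LINT y|lborel. heat_kernel (t - a) (x - y) * (indicator {0<..<a} s * M))"
          by (intro integral_mono integrable_norm i' integrable_mult_left integrable_heat_kernel)
             (use a in \<open>auto simp: heat_kernel_nonneg indicator_def intro!: mult_left_mono norm_heat_apply_le\<close>)
        also have "\<dots> = indicator {0<..<a} s * M"
          using a by (simp add: integral_heat_kernel)
        finally show ?thesis .
      qed
      thus "AE s in lborel. norm (LINT y|lborel. norm (case (s, y) of (s, y) \<Rightarrow> ?f s y)) \<le> norm (indicator {0<..<a} s * M)"
        using M_nonneg by (intro AE_I2) (auto simp: abs_mult)
    qed
  qed
  have "heat (t - a) (duhamel \<phi> a) x = (LINT y|lborel. LINT s|lborel. ?f s y)"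
    using a by (simp add: apply_heat heat_semigroup_eq apply_duhamel ndd flip: integral_scaleR_right)
  also have "\<dots> = (LINT s|lborel. LINT y|lborel. ?f s y)"
    by (rule lborel_pair.Fubini_integral[OF int])
  also have "\<dots> = (LINT s|lborel. indicator {0<..<a} s *\<^sub>R heat (t - s) (\<phi> s) x)"
  proof (rule Bochner_Integration.integral_cong[OF refl])
    fix s
    have "heat (t - s) (\<phi> s) x = heat (t - a) (heat (a - s) (\<phi> s)) x" if "s \<in> {0<..<a}"
      using that a by (subst heat_heat) auto
    thus "(LINT y|lborel. ?f s y) = indicator {0<..<a} s *\<^sub>R heat (t - s) (\<phi> s) x"
      using a by (auto simp: indicator_def apply_heat[of "t - a"] heat_semigroup_eq)
  qed
  also have "\<dots> = (LINT s:{0..a}|lborel. heat (t - s) (\<phi> s) x)" by (rule ndd[symmetric])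
  finally show ?thesis .
qed

lemma integral_split:
  assumes "0 \<le> a" "a \<le> b" "b \<le> t"
  shows "(LINT s:{0..b}|lborel. heat (t - s) (\<phi> s) x) =
    (LINT s:{0..a}|lborel. heat (t - s) (\<phi> s) x) + (LINT s:{a..b}|lborel. heat (t - s) (\<phi> s) x)"
proof -
  have "(LINT s:{0..a} \<union> {a..b}|lborel. heat (t - s) (\<phi> s) x) =
    (LINT s:{0..a}|lborel. heat (t - s) (\<phi> s) x) + (LINT s:{a..b}|lborel. heat (t - s) (\<phi> s) x)"
  proof (rule set_integral_Un_AE)
    show "AE s in lborel. \<not> (s \<in> {0..a} \<and> s \<in> {a..b})"
      using AE_lborel_singleton[of a] by eventually_elim auto
  qed (use assms in \<open>auto intro!: set_integrable_integrand\<close>)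
  thus ?thesis using assms by (simp add: ivl_disj_un)
qed

lemma dist_duhamel_heat_le:
  assumes "0 \<le> a" "a \<le> t"
  shows "dist (duhamel \<phi> t) (heat (t - a) (duhamel \<phi> a)) \<le> M * (t - a)"
proof (rule dist_bound)
  fix x
  show "dist (duhamel \<phi> t x) (heat (t - a) (duhamel \<phi> a) x) \<le> M * (t - a)"
    using norm_integral_integrand_le[of a t t x] assms integral_split[of a t t x]
    by (simp add: heat_duhamel apply_duhamel dist_norm)
qed

text \<open>
  For fixed \<open>a < t0\<close> the evolution of the integral up to time \<open>a\<close> under the semigroup is continuous
  at \<open>t0\<close>, and the remaining piece of the integral has norm at most \<open>M (t - a)\<close>.
\<close>

lemma continuous_on_duhamel: "continuous_on {0<..} (duhamel \<phi>)"
proof (intro continuous_at_imp_continuous_on ballI)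
  fix t0 :: real assume t0: "t0 \<in> {0<..}"
  show "isCont (duhamel \<phi>) t0"
    unfolding isCont_def tendsto_iff
  proof safe
    fix e :: real assume e: "e > 0"
    \<comment> \<open>Close enough to \<open>t0\<close> for the remaining piece of the integral to be at most \<open>e/4\<close>.\<close>
    define a where "a = max 0 (t0 - e / (4 * (M + 1)))"
    have a: "0 \<le> a" "a < t0" using t0 e M_nonneg by (auto simp: a_def)
    have "M * (t0 - a) \<le> M * (e / (4 * (M + 1)))"
      by (intro mult_left_mono M_nonneg) (auto simp: a_def)
    also have "\<dots> \<le> e / 4" using M_nonneg e by (simp add: field_simps)
    finally have Ma: "M * (t0 - a) \<le> e / 4" .
    have "((\<lambda>t. heat (t - a) (duhamel \<phi> a)) \<longlongrightarrow> heat (t0 - a) (duhamel \<phi> a)) (at t0)"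
      by (intro tendsto_heat tendsto_intros) (use a in auto)
    hence "\<forall>\<^sub>F t in at t0. dist (heat (t - a) (duhamel \<phi> a)) (heat (t0 - a) (duhamel \<phi> a)) < e / 4"
      by (rule tendstoD) (use e in simp)
    moreover have "((\<lambda>t. M * (t - a)) \<longlongrightarrow> M * (t0 - a)) (at t0)" by (intro tendsto_intros)
    hence "\<forall>\<^sub>F t in at t0. M * (t - a) < e / 2"
      by (rule order_tendstoD) (use Ma e in auto)
    moreover have "\<forall>\<^sub>F t in at t0. t > a"
      by (rule order_tendstoD[OF tendsto_ident_at a(2)])
    ultimately show "\<forall>\<^sub>F t in at t0. dist (duhamel \<phi> t) (duhamel \<phi> t0) < e"
    proof eventually_elim
      case (elim t)
      have "dist (duhamel \<phi> t) (heat (t - a) (duhamel \<phi> a)) \<le> M * (t - a)"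
           "dist (duhamel \<phi> t0) (heat (t0 - a) (duhamel \<phi> a)) \<le> M * (t0 - a)"
        using a elim by (intro dist_duhamel_heat_le; simp)+
      thus ?case using elim Ma e
          dist_triangle[of "duhamel \<phi> t" "duhamel \<phi> t0" "heat (t - a) (duhamel \<phi> a)"]
          dist_triangle2[of "heat (t - a) (duhamel \<phi> a)" "duhamel \<phi> t0" "heat (t0 - a) (duhamel \<phi> a)"]
        by linarith
    qed
  qed
qed

end

lemma dist_duhamel_le:
  assumes "duhamel_source \<phi> M" "duhamel_source \<psi> M'" "t \<ge> 0" and b: "set_integrable lborel {0..t} b"
    and le: "\<And>s. s \<in> {0..t} \<Longrightarrow> dist (\<phi> s) (\<psi> s) \<le> b s"
  shows "dist (duhamel \<phi> t) (duhamel \<psi> t) \<le> (LINT s:{0..t}|lborel. b s)"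
proof (rule dist_bound)
  fix x
  interpret \<phi>: duhamel_source \<phi> M by fact
  interpret \<psi>: duhamel_source \<psi> M' by fact
  note int = \<phi>.set_integrable_integrand[of 0 t t x] \<psi>.set_integrable_integrand[of 0 t t x]
  have "dist (duhamel \<phi> t x) (duhamel \<psi> t x) =
     norm (LINT s:{0..t}|lborel. heat (t - s) (\<phi> s) x - heat (t - s) (\<psi> s) x)"
    using int assms(3) by (simp add: dist_norm \<phi>.apply_duhamel \<psi>.apply_duhamel)
  also have "\<dots> \<le> (LINT s:{0..t}|lborel. b s)"
  proof (rule norm_set_integral_le[OF _ b])
    show "set_integrable lborel {0..t} (\<lambda>s. heat (t - s) (\<phi> s) x - heat (t - s) (\<psi> s) x)"
      using int assms(3) by simp
    show "norm (heat (t - s) (\<phi> s) x - heat (t - s) (\<psi> s) x) \<le> b s" if "s \<in> {0..t}" for s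
      using that le[OF that] dist_bounded[of "heat (t - s) (\<phi> s)" x "heat (t - s) (\<psi> s)"]
        dist_heat_le[of "t - s" "\<phi> s" "\<psi> s"] unfolding dist_norm[symmetric] by simp
  qed
  finally show "dist (duhamel \<phi> t x) (duhamel \<psi> t x) \<le> (LINT s:{0..t}|lborel. b s)" .
qed

section \<open>Global solutions for bounded Lipschitz nonlinearities\<close>

locale bounded_lipschitz =
  fixes G :: "complex \<Rightarrow> complex" and C M :: real
  assumes lip: "C-lipschitz_on UNIV G" and bound: "\<And>z. norm (G z) \<le> M"
begin

definition nemytskii :: "('a::topological_space \<Rightarrow>\<^sub>C complex) \<Rightarrow> ('a \<Rightarrow>\<^sub>C complex)" where
  "nemytskii f = Bcontfun (\<lambda>x. G (f x))"

lemma C_nonneg: "C \<ge> 0"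
  by (rule lipschitz_on_nonneg[OF lip])

lemma compose_in_bcontfun: "(\<lambda>x. G (apply_bcontfun f x)) \<in> bcontfun"
  by (rule bcontfun_normI[OF continuous_on_compose2[OF lipschitz_on_continuous_on[OF lip]] bound]) auto

lemma apply_nemytskii [simp]: "nemytskii f x = G (f x)"
  by (simp add: nemytskii_def Bcontfun_inverse compose_in_bcontfun)

lemma norm_nemytskii_le: "norm (nemytskii f) \<le> M"
  by (rule norm_bound) (simp add: bound)

lemma dist_nemytskii_le: "dist (nemytskii f) (nemytskii h) \<le> C * dist f h"
proof (rule dist_bound)
  fix x
  have "dist (nemytskii f x) (nemytskii h x) \<le> C * dist (f x) (h x)"
    using lipschitz_onD[OF lip] by simp
  also have "\<dots> \<le> C * dist f h" by (intro mult_left_mono dist_bounded C_nonneg)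
  finally show "dist (nemytskii f x) (nemytskii h x) \<le> C * dist f h" .
qed

lemma source_nemytskii:
  fixes u :: "real \<Rightarrow> (real ^ 'd) \<Rightarrow>\<^sub>C complex"
  assumes "continuous_on {0<..} u"
  shows "duhamel_source (\<lambda>s. nemytskii (u s)) M"
proof
  have "C-lipschitz_on UNIV (nemytskii :: ((real ^ 'd) \<Rightarrow>\<^sub>C complex) \<Rightarrow> _)"
    by (rule lipschitz_onI[OF dist_nemytskii_le C_nonneg])
  from lipschitz_on_continuous_on[OF this] assms show "continuous_on {0<..} (\<lambda>s. nemytskii (u s))"
    by (rule continuous_on_compose2) auto
qed (rule norm_nemytskii_le)

text \<open>
  A solution on \<open>(0, \<infinity>)\<close> is written as \<open>u(s) = e\<^sup>L\<^sup>s w(ln s)\<close> with a bounded continuous curve \<open>w\<close> on the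
  whole line. The weight makes Duhamel's map a contraction for large \<open>L\<close>, and the logarithmic
  time removes the point \<open>0\<close>, where the heat flow of \<open>g\<close> need not be continuous in norm.
\<close>

lemma exists_global_solution:
  fixes g :: "(real ^ 'd) \<Rightarrow>\<^sub>C complex"
  shows "\<exists>u. u 0 = g \<and> continuous_on {0<..} u \<and>
           (\<forall>t\<ge>0. u t = heat t g + duhamel (\<lambda>s. nemytskii (u s)) t)"
proof -
  \<comment> \<open>In the weighted norm Duhamel's map has Lipschitz constant at most \<open>C / L \<le> 1/2\<close>.\<close>
  define L where "L = 2 * C + 1"
  have L: "L > 0" "C / L \<le> 1 / 2" using C_nonneg by (auto simp: L_def field_simps)
  define U :: "(real \<Rightarrow>\<^sub>C (real ^ 'd) \<Rightarrow>\<^sub>C complex) \<Rightarrow> real \<Rightarrow> (real ^ 'd) \<Rightarrow>\<^sub>C complex" where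
    "U = (\<lambda>w s. exp (L * s) *\<^sub>R w (ln s))"
  \<comment> \<open>Duhamel's map in the unknown \<open>w\<close>, at time \<open>t = e\<^sup>\<tau>\<close>.\<close>
  define V where "V = (\<lambda>w \<tau>. exp (- L * exp \<tau>) *\<^sub>R (heat (exp \<tau>) g + duhamel (\<lambda>s. nemytskii (U w s)) (exp \<tau>)))"
  define T where "T = (\<lambda>w. Bcontfun (V w))"
  have contU: "continuous_on {0<..} (U w)" for w
    unfolding U_def
    by (intro continuous_intros continuous_on_compose2[OF continuous_on_apply_bcontfun[of UNIV w]]) auto
  have src: "duhamel_source (\<lambda>s. nemytskii (U w s)) M" for w by (rule source_nemytskii[OF contU])
  have "V w \<in> bcontfun" for w
  proof (rule bcontfun_normI)
    interpret duhamel_source "\<lambda>s. nemytskii (U w s)" M by (rule src)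
    show "continuous_on UNIV (V w)"
      unfolding V_def
      by (intro continuous_intros continuous_on_heat continuous_on_compose2[OF continuous_on_duhamel]) auto
    show "norm (V w \<tau>) \<le> norm g + M / L" for \<tau>
    proof -
      define t where "t = exp \<tau>"
      have t: "t > 0" by (simp add: t_def)
      have "L * t \<le> exp (L * t)" using exp_ge_add_one_self[of "L * t"] by linarith
      hence te: "exp (- L * t) * t \<le> 1 / L" using L by (simp add: exp_minus field_simps)
      have "norm (V w \<tau>) \<le> exp (- L * t) * (norm g + M * t)"
        unfolding V_def t_def[symmetric] norm_scaleR using t
        by (auto intro!: mult_left_mono order.trans[OF norm_triangle_ineq] add_mono norm_heat_le norm_duhamel_le)
      also have "\<dots> = exp (- L * t) * norm g + M * (exp (- L * t) * t)" by (simp add: algebra_simps)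
      also have "\<dots> \<le> 1 * norm g + M * (1 / L)"
        using t L M_nonneg te by (intro add_mono mult_right_mono mult_left_mono) auto
      finally show ?thesis by simp
    qed
  qed
  hence T: "apply_bcontfun (T w) = V w" for w by (simp add: T_def Bcontfun_inverse)
  have contr: "dist (T w) (T w') \<le> 1 / 2 * dist w w'" for w w'
  proof (rule dist_bound)
    fix \<tau> :: real
    define t where "t = exp \<tau>"
    have t: "t > 0" by (simp add: t_def)
    define b where "b = (\<lambda>s. C * (exp (L * s) * dist w w'))"
    have FTC: "(\<integral>s. b s * indicator {0..t} s \<partial>lborel) = C * (exp (L * t) / L * dist w w') - C * (exp (L * 0) / L * dist w w')"
      by (rule integral_FTC_Icc_real)
         (use t L in \<open>auto simp: b_def intro!: derivative_eq_intros continuous_intros\<close>)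
    have "dist (V w \<tau>) (V w' \<tau>) = exp (- L * t) * dist (duhamel (\<lambda>s. nemytskii (U w s)) t) (duhamel (\<lambda>s. nemytskii (U w' s)) t)"
      unfolding V_def t_def[symmetric] dist_norm by (simp flip: scaleR_diff_right)
    also have "\<dots> \<le> exp (- L * t) * (LINT s:{0..t}|lborel. b s)"
    proof (intro mult_left_mono dist_duhamel_le[OF src src])
      show "set_integrable lborel {0..t} b"
        by (rule borel_integrable_atLeastAtMost') (auto simp: b_def intro!: continuous_intros)
      fix s assume "s \<in> {0..t}"
      have "dist (nemytskii (U w s)) (nemytskii (U w' s)) \<le> C * dist (U w s) (U w' s)"
        by (rule dist_nemytskii_le)
      also have "dist (U w s) (U w' s) = exp (L * s) * dist (w (ln s)) (w' (ln s))"
        by (simp add: U_def dist_norm flip: scaleR_diff_right)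
      also have "C * \<dots> \<le> b s"
        unfolding b_def by (intro mult_left_mono dist_bounded C_nonneg) auto
      finally show "dist (nemytskii (U w s)) (nemytskii (U w' s)) \<le> b s" by simp
    qed (use t in auto)
    also have "(LINT s:{0..t}|lborel. b s) = C / L * dist w w' * (exp (L * t) - 1)"
      using FTC L by (simp add: set_lebesgue_integral_def mult.commute) (simp add: field_simps)
    also have "exp (- L * t) * (C / L * dist w w' * (exp (L * t) - 1)) = C / L * dist w w' * (1 - exp (- L * t))"
      by (simp add: algebra_simps exp_minus)
    also have "\<dots> \<le> C / L * dist w w' * 1"
      using L C_nonneg by (intro mult_left_mono) auto
    also have "\<dots> \<le> 1 / 2 * dist w w'"
      using mult_right_mono[OF L(2), of "dist w w'"] by simp
    finally show "dist (T w \<tau>) (T w' \<tau>) \<le> 1 / 2 * dist w w'" by (simp add: T)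
  qed
  have "\<exists>!w. T w = w"
    by (rule banach_fix_type[of "1/2"]) (use contr in auto)
  then obtain w where w: "T w = w" by blast
  define u where "u = (\<lambda>s. if s \<le> 0 then g else U w s)"
  have dc: "duhamel (\<lambda>s. nemytskii (u s)) t = duhamel (\<lambda>s. nemytskii (U w s)) t" for t
    by (rule duhamel_cong) (simp add: u_def)
  interpret duhamel_source "\<lambda>s. nemytskii (U w s)" M by (rule src)
  have "u t = heat t g + duhamel (\<lambda>s. nemytskii (u s)) t" if "t \<ge> 0" for t
  proof (cases "t = 0")
    case True
    have "duhamel (\<lambda>s. nemytskii (U w s)) 0 = 0" using norm_duhamel_le[of 0] by simp
    thus ?thesis using True unfolding dc by (simp add: u_def)
  next
    case False
    hence t: "t > 0" using that by simp
    have "w (ln t) = V w (ln t)" by (metis T w)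
    thus ?thesis using t
      by (simp add: u_def dc[unfolded u_def] U_def V_def flip: exp_add)
  qed
  moreover have "continuous_on {0<..} u"
    using contU[of w] by (rule continuous_on_eq) (auto simp: u_def)
  ultimately show ?thesis by (intro exI[of _ u]) (auto simp: u_def)
qed

end

locale global_solution = bounded_lipschitz +
  fixes g :: "(real ^ 'd) \<Rightarrow>\<^sub>C complex" and u :: "real \<Rightarrow> (real ^ 'd) \<Rightarrow>\<^sub>C complex"
  assumes u_0: "u 0 = g" and cont_u: "continuous_on {0<..} u"
    and duhamel_eq: "\<And>t. t \<ge> 0 \<Longrightarrow> u t = heat t g + duhamel (\<lambda>s. nemytskii (u s)) t"
begin

sublocale duhamel_source "\<lambda>s. nemytskii (u s)" M
  by (rule source_nemytskii[OF cont_u])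

lemma solution_ge:
  assumes l: "bounded_linear l" and a: "\<And>y. (a::real) \<le> l (g y)"
    and c: "\<And>s y. 0 \<le> s \<Longrightarrow> s \<le> t \<Longrightarrow> c \<le> l (G (u s y))" and t: "t \<ge> 0"
  shows "a + c * t \<le> l (u t x)"
proof -
  interpret l: bounded_linear l by (rule l)
  have "c * (t - 0) \<le> l (LINT s:{0..t}|lborel. heat (t - s) (nemytskii (u s)) x)"
    by (rule set_integral_ge[OF set_integrable_integrand l])
       (use t in \<open>auto simp: apply_heat intro!: heat_semigroup_ge[OF _ l] c\<close>)
  moreover have "a \<le> l (heat t g x)"
    using t by (simp add: apply_heat heat_semigroup_ge[OF _ l a])
  ultimately show ?thesis
    by (simp add: duhamel_eq[OF t] plus_bcontfun.rep_eq l.add apply_duhamel[OF t])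
qed

lemma dist_solution_heat_le: "t \<ge> 0 \<Longrightarrow> dist (u t) (heat t g) \<le> M * t"
  using norm_duhamel_le by (simp add: duhamel_eq dist_norm)

text \<open>
  Evolving the solution from time \<open>s\<close> to time \<open>t\<close> by the heat flow alone omits precisely the
  source after time \<open>s\<close>. As a function of \<open>s\<close> this is an antiderivative of the integrand.
\<close>

lemma heat_solution:
  assumes "0 \<le> s" "s \<le> t"
  shows "heat (t - s) (u s) x = heat t g x + (LINT r:{0..s}|lborel. heat (t - r) (nemytskii (u r)) x)"
  using assms
  by (simp add: duhamel_eq heat_add heat_heat plus_bcontfun.rep_eq heat_duhamel)

section \<open>Positivity of the imaginary part\<close>

text \<open>
  Set \<open>y(s) = Im (e\<^sup>(\<^sup>t\<^sup>-\<^sup>s\<^sup>)\<^sup>\<Delta> u(s))(x)\<close>. Then \<open>y'(s) = Im (e\<^sup>(\<^sup>t\<^sup>-\<^sup>s\<^sup>)\<^sup>\<Delta> G(u(s)))(x) \<ge> - K y(s)\<close>, so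
  \<open>e\<^sup>K\<^sup>s y(s)\<close> is nondecreasing.
\<close>

lemma Im_solution_ge_exp:
  assumes G: "\<And>z. Im z \<ge> 0 \<Longrightarrow> - K * Im z \<le> Im (G z)" and t: "t \<ge> 0"
    and nn: "\<And>s y. 0 \<le> s \<Longrightarrow> s < t \<Longrightarrow> 0 \<le> Im (u s y)" and c: "\<And>y. c \<le> Im (g y)"
  shows "c * exp (- K * t) \<le> Im (u t x)"
proof -
  define h where "h = (\<lambda>r. heat (t - r) (nemytskii (u r)) x)"
  define y where "y = (\<lambda>s. Im (heat t g x + integral {0..s} h))"
  have y: "y s = Im (heat (t - s) (u s) x)" if "0 \<le> s" "s \<le> t" for s
    unfolding y_def heat_solution[OF that] h_def using that
    by (subst set_borel_integral_eq_integral(2)[OF set_integrable_integrand]) auto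
  have int: "h integrable_on {0..t}"
    unfolding h_def by (rule set_borel_integral_eq_integral(1)[OF set_integrable_integrand]) (use t in auto)
  \<comment> \<open>Here \<open>y 0\<close> is the heat flow of \<open>g\<close> and \<open>y t\<close> is the solution itself.\<close>
  have "exp (K * 0) * y 0 \<le> exp (K * t) * y t"
  proof (rule DERIV_nonneg_imp_increasing_open[OF t])
    show "continuous_on {0..t} (\<lambda>s. exp (K * s) * y s)"
      unfolding y_def by (intro continuous_intros indefinite_integral_continuous_1 int)
    fix s assume s: "0 < s" "s < t"
    have "isCont h s"
      using continuous_on_integrand_apply[of t x] s by (simp add: h_def continuous_on_eq_continuous_at)
    hence "((\<lambda>s. integral {0..s} h) has_vector_derivative h s) (at s within {0..t})"
      using s continuous_at_imp_continuous_within[OF \<open>isCont h s\<close>]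
        integral_has_vector_derivative_continuous_at[OF int, of s "{}"] by simp
    moreover have "at s within {0..t} = at s"
      using s by (intro at_within_interior) auto
    ultimately have "((\<lambda>s. integral {0..s} h) has_vector_derivative h s) (at s)" by simp
    hence "((\<lambda>s. heat t g x + integral {0..s} h) has_vector_derivative h s) (at s)"
      by (auto intro!: derivative_eq_intros)
    hence "(y has_real_derivative Im (h s)) (at s)"
      unfolding y_def has_real_derivative_iff_has_vector_derivative
      by (rule bounded_linear.has_vector_derivative[OF bounded_linear_Im])
    hence "((\<lambda>s. exp (K * s) * y s) has_real_derivative exp (K * s) * (K * y s + Im (h s))) (at s)"
      by (auto intro!: derivative_eq_intros simp: algebra_simps)
    moreover have "0 \<le> K * y s + Im (h s)"
    proof -
      have "0 \<le> Im ((nemytskii (u s) + K *\<^sub>R u s) z)" for z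
        using G[of "u s z"] nn[of s z] s by (simp add: plus_bcontfun.rep_eq scaleR_bcontfun.rep_eq)
      moreover have ts: "0 \<le> t - s" using s by simp
      ultimately have "0 \<le> Im (heat_semigroup (t - s) (nemytskii (u s) + K *\<^sub>R u s) x)"
        by (intro heat_semigroup_ge[OF _ bounded_linear_Im])
      hence "0 \<le> Im (heat (t - s) (nemytskii (u s) + K *\<^sub>R u s) x)"
        unfolding apply_heat[OF ts] .
      thus ?thesis
        using s by (simp add: heat_add heat_scaleR plus_bcontfun.rep_eq scaleR_bcontfun.rep_eq y h_def)
    qed
    ultimately show "\<exists>d. ((\<lambda>s. exp (K * s) * y s) has_real_derivative d) (at s) \<and> d \<ge> 0"
      by (intro exI[of _ "exp (K * s) * (K * y s + Im (h s))"]) auto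
  qed
  moreover have "c \<le> y 0"
    using t by (simp add: y u_0 apply_heat heat_semigroup_ge[OF _ bounded_linear_Im c])
  ultimately have "c \<le> exp (K * t) * Im (u t x)" using t by (simp add: y)
  thus ?thesis by (simp add: exp_minus field_simps)
qed

text \<open>
  Consider the first time \<open>t0\<close> after which negative values occur. Up to \<open>t0\<close> the exponential bound
  applies and leaves a margin that is uniform in \<open>x\<close>, which by continuity in norm persists a
  little longer. At \<open>t0 = 0\<close> continuity is replaced by the comparison with the heat flow of \<open>g\<close>.
\<close>

lemma Im_solution_pos:
  assumes G: "\<And>z. Im z \<ge> 0 \<Longrightarrow> - K * Im z \<le> Im (G z)"
    and c: "c > 0" "\<And>y. c \<le> Im (g y)" and t: "t \<ge> 0"
  shows "0 < Im (u t x)"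
proof -
  define B where "B = {t. t \<ge> 0 \<and> (\<exists>y. Im (u t y) < 0)}"
  have "B = {}"
  proof (rule ccontr)
    assume ne: "B \<noteq> {}"
    define t0 where "t0 = Inf B"
    have bdd: "bdd_below B" by (auto simp: B_def bdd_below_def)
    have t0: "t0 \<ge> 0" unfolding t0_def using ne by (intro cInf_greatest) (auto simp: B_def)
    have nn: "0 \<le> Im (u s y)" if "0 \<le> s" "s < t0" for s y
    proof (rule ccontr)
      assume "\<not> 0 \<le> Im (u s y)"
      hence "s \<in> B" using that by (auto simp: B_def not_le)
      from cInf_lower[OF this bdd] that show False by (simp add: t0_def)
    qed
    define e where "e = c * exp (- K * t0)"
    have e: "e > 0" using c by (simp add: e_def)
    have ge: "e \<le> Im (u t0 y)" for y
      unfolding e_def by (rule Im_solution_ge_exp[OF G t0 nn c(2)])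
    have "\<exists>d>0. \<forall>t y. t0 \<le> t \<and> t < t0 + d \<longrightarrow> 0 \<le> Im (u t y)"
    proof (cases "t0 = 0")
      case True
      have "0 \<le> Im (u t y)" if "0 \<le> t" "t < c / (M + 1)" for t y
      proof -
        have "t * (M + 1) < c" using that M_nonneg by (simp add: field_simps)
        hence "M * t < c" using that by (simp add: algebra_simps)
        moreover have "c \<le> Im (heat t g y)"
          using that by (simp add: apply_heat heat_semigroup_ge[OF _ bounded_linear_Im c(2)])
        moreover have "\<bar>Im (u t y - heat t g y)\<bar> \<le> M * t"
          using dist_solution_heat_le[OF that(1)] dist_bounded[of "u t" y "heat t g"]
            abs_Im_le_cmod[of "u t y - heat t g y"] by (simp add: dist_norm)
        ultimately show ?thesis by simp
      qed
      thus ?thesis using True c M_nonneg by (intro exI[of _ "c / (M + 1)"]) auto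
    next
      case False
      hence "isCont u t0" using cont_u t0 by (simp add: continuous_on_eq_continuous_at)
      then obtain d where d: "d > 0" "\<And>t. dist t t0 < d \<Longrightarrow> dist (u t) (u t0) < e"
        using e unfolding continuous_at_eps_delta by blast
      have "0 \<le> Im (u t y)" if "t0 \<le> t" "t < t0 + d" for t y
      proof -
        have "\<bar>Im (u t y - u t0 y)\<bar> \<le> e"
          using d(2)[of t] dist_bounded[of "u t" y "u t0"] that
            abs_Im_le_cmod[of "u t y - u t0 y"] by (simp add: dist_norm)
        thus ?thesis using ge[of y] by simp
      qed
      thus ?thesis using d by blast
    qed
    then obtain d where d: "d > 0" "\<And>t y. t0 \<le> t \<Longrightarrow> t < t0 + d \<Longrightarrow> 0 \<le> Im (u t y)" by blast
    obtain b where b: "b \<in> B" "b < t0 + d"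
      using cInf_lessD[OF ne, of "t0 + d"] d(1) by (auto simp: t0_def)
    have "t0 \<le> b" unfolding t0_def by (rule cInf_lower[OF b(1) bdd])
    obtain z where "Im (u b z) < 0" using b(1) by (auto simp: B_def)
    with d(2)[OF \<open>t0 \<le> b\<close> b(2), of z] show False by simp
  qed
  hence nn: "0 \<le> Im (u s y)" if "0 \<le> s" for s y
    using that by (metis (mono_tags, lifting) B_def empty_iff mem_Collect_eq not_le)
  have "0 < c * exp (- K * t)" using c by simp
  also have "\<dots> \<le> Im (u t x)"
    by (rule Im_solution_ge_exp[OF G t nn c(2)])
  finally show ?thesis .
qed

end

section \<open>Mild solutions and their uniqueness\<close>

lemma (in global_solution) mild_solution:
  assumes FG: "\<And>t x. t \<ge> 0 \<Longrightarrow> F (u t x) = G (u t x)"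
    and no_pole: "\<And>t x. t \<ge> 0 \<Longrightarrow> \<not> is_pole F (u t x)"
  shows "mild_solution F g \<infinity> u"
  unfolding mild_solution_def
proof (intro conjI allI impI)
  show "u 0 = g" by (rule u_0)
  show "continuous_on {t. 0 < t \<and> ereal t < \<infinity>} u"
    using cont_u by (simp add: greaterThan_def)
  show "uniform_limit UNIV (\<lambda>t x. u t x - heat_semigroup t g x) (\<lambda>_. 0) (at_right 0)"
    unfolding uniform_limit_iff
  proof safe
    fix e :: real assume e: "e > 0"
    have "\<forall>\<^sub>F t in at_right 0. t < e / (M + 1)"
      by (rule order_tendstoD(2)[OF tendsto_ident_at]) (use e M_nonneg in simp)
    moreover have "\<forall>\<^sub>F t :: real in at_right 0. t > 0" by (rule eventually_at_right_less)
    ultimately show "\<forall>\<^sub>F t in at_right 0. \<forall>x\<in>UNIV. dist (u t x - heat_semigroup t g x) 0 < e"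
    proof eventually_elim
      case (elim t)
      hence "t * (M + 1) < e" using M_nonneg by (simp add: field_simps)
      hence "M * t < e" using elim by (simp add: algebra_simps)
      moreover have "norm (u t x - heat_semigroup t g x) \<le> M * t" for x
        using dist_solution_heat_le[of t] dist_bounded[of "u t" x "heat t g"] elim
        by (simp add: dist_norm apply_heat)
      ultimately show ?case by (auto intro: le_less_trans)
    qed
  qed
next
  fix t :: real and x :: "real ^ 'd" assume t: "0 \<le> t"
  show "\<not> is_pole F (u t x)" by (rule no_pole[OF t])
  show "(\<lambda>x. F (u t x)) \<in> bcontfun"
    using compose_in_bcontfun[of "u t"] by (simp add: FG t)
  have eq: "heat_semigroup (t - s) (\<lambda>y. F (u s y)) x = heat (t - s) (nemytskii (u s)) x" if "s \<in> {0..t}" for s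
  proof -
    have "(\<lambda>y. F (u s y)) = apply_bcontfun (nemytskii (u s))"
      using that by (auto simp: fun_eq_iff FG)
    thus ?thesis using that by (simp add: apply_heat)
  qed
  show "set_integrable lborel {0..t} (\<lambda>s. heat_semigroup (t - s) (\<lambda>y. F (u s y)) x)"
    using set_integrable_integrand[of 0 t t x] t by (subst set_integrable_cong[OF refl refl eq]) auto
  have "(LINT s:{0..t}|lborel. heat_semigroup (t - s) (\<lambda>y. F (u s y)) x)
      = (LINT s:{0..t}|lborel. heat (t - s) (nemytskii (u s)) x)"
    by (rule set_lebesgue_integral_cong) (use eq in auto)
  thus "u t x = heat_semigroup t g x + (LINT s:{0..t}|lborel. heat_semigroup (t - s) (\<lambda>y. F (u s y)) x)"
    using t by (simp add: duhamel_eq[OF t] plus_bcontfun.rep_eq apply_heat apply_duhamel)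
qed

lemma dist_heat_semigroup_le:
  fixes f h :: "(real ^ 'd) \<Rightarrow>\<^sub>C complex"
  assumes "t \<ge> 0" "\<And>y. dist (f y) (h y) \<le> d"
  shows "dist (heat_semigroup t f x) (heat_semigroup t h x) \<le> d"
proof -
  have "dist (heat t f x) (heat t h x) \<le> dist f h"
    by (rule order.trans[OF dist_bounded dist_heat_le[OF assms(1)]])
  also have "\<dots> \<le> d" by (rule dist_bound[OF assms(2)])
  finally show ?thesis by (simp add: apply_heat assms(1))
qed

text \<open>
  Two solutions that agree before \<open>t0\<close> have Duhamel integrals that differ only by the part after
  \<open>t0\<close>.
\<close>

lemma mild_solution_dist_le:
  fixes u v :: "real \<Rightarrow> (real ^ 'd) \<Rightarrow>\<^sub>C complex"
  assumes u: "mild_solution F g T u" and v: "mild_solution F g T' v"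
    and t: "ereal t < T" "ereal t < T'" "0 \<le> t0" "t0 \<le> t"
    and lip: "K-lipschitz_on E F"
    and eq: "\<And>s. 0 \<le> s \<Longrightarrow> s < t0 \<Longrightarrow> v s = u s"
    and E: "\<And>s y. t0 \<le> s \<Longrightarrow> s \<le> t \<Longrightarrow> u s y \<in> E" "\<And>s y. t0 \<le> s \<Longrightarrow> s \<le> t \<Longrightarrow> v s y \<in> E"
    and D: "\<And>s. t0 \<le> s \<Longrightarrow> s \<le> t \<Longrightarrow> dist (v s) (u s) \<le> D"
  shows "dist (v t) (u t) \<le> K * D * (t - t0)"
proof (rule dist_bound)
  fix x :: "real ^ 'd"
  have T: "ereal s < T" "ereal s < T'" if "s \<le> t" for s
    using t that by (auto intro: order.strict_trans1[of "ereal s" "ereal t"])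
  let ?I = "\<lambda>w s. heat_semigroup (t - s) (\<lambda>y. F (apply_bcontfun (w s) y)) x"
  have int: "set_integrable lborel {0..t} (?I u)" "set_integrable lborel {0..t} (?I v)"
    and eqs: "u t x = heat_semigroup t g x + (LINT s:{0..t}|lborel. ?I u s)"
             "v t x = heat_semigroup t g x + (LINT s:{0..t}|lborel. ?I v s)"
    using u v t unfolding mild_solution_def by auto
  have K: "K \<ge> 0" by (rule lipschitz_on_nonneg[OF lip])
  have D0: "D \<ge> 0" by (rule order.trans[OF zero_le_dist D[of t]]) (use t in auto)
  have le: "norm (?I v s - ?I u s) \<le> indicator {t0..t} s *\<^sub>R (K * D)" if s: "s \<in> {0..t}" for s
  proof (cases "s < t0")
    case True
    with eq s K D0 show ?thesis by simp
  next
    case False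
    have "(\<lambda>y. F (u s y)) \<in> bcontfun" "(\<lambda>y. F (v s y)) \<in> bcontfun"
      using s u v T[of s] unfolding mild_solution_def by auto
    then obtain fu fv where f: "(\<lambda>y. F (u s y)) = apply_bcontfun fu" "(\<lambda>y. F (v s y)) = apply_bcontfun fv"
      by (metis bcontfunE)
    have "dist (fv y) (fu y) \<le> K * D" for y
    proof -
      have "dist (F (v s y)) (F (u s y)) \<le> K * dist (v s y) (u s y)"
        using False s by (intro lipschitz_onD[OF lip] E) auto
      also have "\<dots> \<le> K * D"
        using False s by (intro mult_left_mono K order.trans[OF dist_bounded D]) auto
      finally show ?thesis by (metis f)
    qed
    hence "dist (?I v s) (?I u s) \<le> K * D"
      unfolding f using s by (intro dist_heat_semigroup_le) auto
    thus ?thesis using False s by (simp add: dist_norm)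
  qed
  have "dist (v t x) (u t x) = norm (LINT s:{0..t}|lborel. ?I v s - ?I u s)"
    using int by (simp add: eqs dist_norm)
  also have "\<dots> \<le> (LINT s:{0..t}|lborel. indicator {t0..t} s *\<^sub>R (K * D))"
  proof (rule norm_set_integral_le)
    show "set_integrable lborel {0..t} (\<lambda>s. indicator {t0..t} s *\<^sub>R (K * D))"
      unfolding set_integrable_def scaleR_scaleR indicator_inter_arith[symmetric]
      by (rule integrable_scaleR_left) (use t in auto)
  qed (use int le in auto)
  also have "\<dots> = (LINT s|lborel. indicator {t0..t} s *\<^sub>R (K * D))"
    unfolding set_lebesgue_integral_def using t
    by (intro Bochner_Integration.integral_cong) (auto simp: indicator_def)
  also have "\<dots> = K * D * (t - t0)" using t by simp
  finally show "dist (v t x) (u t x) \<le> K * D * (t - t0)" .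
qed

text \<open>
  Let \<open>t0\<close> be the first time of difference. On a short interval \<open>[t0, t0 + h]\<close> the other solution
  stays within \<open>r\<close> of \<open>u\<close>, thus in the set \<open>E\<close> where \<open>F\<close> is Lipschitz, and for \<open>K h \<le> 1/2\<close> the
  largest distance there is at most half of itself.
\<close>

lemma mild_solution_unique:
  fixes u v :: "real \<Rightarrow> (real ^ 'd) \<Rightarrow>\<^sub>C complex"
  assumes u: "mild_solution F g T u" and v: "mild_solution F g T' v" and "T' \<le> T"
    and lip: "K-lipschitz_on E F" and r: "r > 0"
    and E: "\<And>t x. 0 \<le> t \<Longrightarrow> ereal t < T \<Longrightarrow> cball (u t x) r \<subseteq> E"
    and t: "t \<ge> 0" "ereal t < T'"
  shows "v t = u t"
proof (rule ccontr)
  assume "v t \<noteq> u t"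
  define B where "B = {t. 0 \<le> t \<and> ereal t < T' \<and> v t \<noteq> u t}"
  have tB: "t \<in> B" using t \<open>v t \<noteq> u t\<close> by (simp add: B_def)
  define t0 where "t0 = Inf B"
  have bdd: "bdd_below B" by (auto simp: B_def bdd_below_def)
  have t0: "0 \<le> t0" unfolding t0_def using tB by (intro cInf_greatest) (auto simp: B_def)
  have "t0 \<le> t" unfolding t0_def by (rule cInf_lower[OF tB bdd])
  hence t0T: "ereal t0 < T'" using t by (auto intro: order.strict_trans1[of "ereal t0" "ereal t"])
  have K: "K \<ge> 0" by (rule lipschitz_on_nonneg[OF lip])
  have below: "v s = u s" if "0 \<le> s" "s < t0" for s
  proof (rule ccontr)
    assume "v s \<noteq> u s"
    hence "s \<in> B" using that t0T by (auto simp: B_def intro: order.strict_trans[of "ereal s" "ereal t0"])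
    from cInf_lower[OF this bdd] that show False by (simp add: t0_def)
  qed
  have "v t0 = u t0 \<and> (\<forall>\<^sub>F s in at_right t0. dist (v s) (u s) \<le> r)"
  proof (cases "t0 = 0")
    case True
    have lim: "\<forall>\<^sub>F s in at_right 0. \<forall>x\<in>UNIV. dist (w s x - heat_semigroup s g x) 0 < r / 2"
      if "mild_solution F g T'' w" for w T''
      by (rule uniform_limitD) (use that r in \<open>auto simp: mild_solution_def\<close>)
    have "\<forall>\<^sub>F s in at_right 0. dist (v s) (u s) \<le> r"
      using lim[OF u] lim[OF v]
    proof eventually_elim
      case (elim s)
      show ?case
      proof (rule dist_bound)
        fix x
        have "dist (v s x) (heat_semigroup s g x) < r / 2" "dist (u s x) (heat_semigroup s g x) < r / 2"
          using elim by (auto simp: dist_norm)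
        thus "dist (v s x) (u s x) \<le> r"
          using dist_triangle2[of "v s x" "u s x" "heat_semigroup s g x"] by linarith
      qed
    qed
    thus ?thesis using True u v by (simp add: mild_solution_def)
  next
    case False
    hence pos: "t0 > 0" using t0 by simp
    have op: "open {s. 0 < s \<and> ereal s < S}" for S :: ereal
      by (cases S) (auto simp: Collect_conj_eq open_Collect_less intro!: open_Int)
    have cont: "isCont w t0" if "mild_solution F g T'' w" "ereal t0 < T''" for w T''
      using that pos continuous_on_eq_continuous_at[OF op] unfolding mild_solution_def by auto
    have lims: "(v \<longlongrightarrow> v t0) (at t0)" "(u \<longlongrightarrow> u t0) (at t0)"
      using cont[OF v t0T] cont[OF u order.strict_trans2[OF t0T \<open>T' \<le> T\<close>]] by (auto simp: isCont_def)
    have "(v \<longlongrightarrow> v t0) (at_left t0)" "(u \<longlongrightarrow> u t0) (at_left t0)"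
      using lims by (auto intro: tendsto_within_subset)
    moreover have "\<forall>\<^sub>F s in at_left t0. v s = u s"
      using eventually_at_left_real[OF pos] by eventually_elim (use below in auto)
    ultimately have eq: "v t0 = u t0"
      using tendsto_cong[of v u "at_left t0" "v t0"] tendsto_unique[of "at_left t0" u] by simp
    have "((\<lambda>s. dist (v s) (u s)) \<longlongrightarrow> dist (v t0) (u t0)) (at t0)"
      by (intro tendsto_dist lims)
    hence "((\<lambda>s. dist (v s) (u s)) \<longlongrightarrow> 0) (at_right t0)"
      using eq by (auto intro: tendsto_within_subset)
    hence "\<forall>\<^sub>F s in at_right t0. dist (v s) (u s) < r" using r by (rule order_tendstoD)
    thus ?thesis using eq by (auto elim: eventually_mono)
  qed
  then obtain b where eq0: "v t0 = u t0" and b: "b > t0" "\<And>s. t0 < s \<Longrightarrow> s < b \<Longrightarrow> dist (v s) (u s) \<le> r"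
    unfolding eventually_at_right_field by blast
  obtain c where c: "c > t0" "ereal c < T'"
    using ereal_dense2[OF t0T] by auto
  \<comment> \<open>Short enough to stay in the region of closeness and in the interval of existence, and for \<open>K h \<le> 1/2\<close>.\<close>
  define h where "h = min (min ((b - t0) / 2) (c - t0)) (1 / (2 * (K + 1)))"
  have h: "h > 0" "t0 + h < b" "t0 + h \<le> c" "K * h \<le> 1 / 2"
  proof -
    show "h > 0" using b c K by (simp add: h_def)
    show "t0 + h < b" using b by (auto simp: h_def min_def field_simps)
    show "t0 + h \<le> c" by (simp add: h_def)
    have "K * h \<le> K * (1 / (2 * (K + 1)))" using K by (intro mult_left_mono) (auto simp: h_def)
    also have "\<dots> \<le> 1 / 2" using K by (simp add: field_simps)
    finally show "K * h \<le> 1 / 2" .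
  qed
  have le_r: "dist (v s) (u s) \<le> r" if "t0 \<le> s" "s \<le> t0 + h" for s
    using that b(2)[of s] h eq0 r by (cases "s = t0") auto
  have T: "ereal s < T'" "ereal s < T" if "s \<le> t0 + h" for s
  proof -
    have "ereal s \<le> ereal c" using that h by simp
    thus "ereal s < T'" by (rule order.strict_trans1[OF _ c(2)])
    thus "ereal s < T" using \<open>T' \<le> T\<close> by (rule order.strict_trans2)
  qed
  define D where "D = (SUP s\<in>{t0..t0+h}. dist (v s) (u s))"
  have D: "dist (v s) (u s) \<le> D" if "t0 \<le> s" "s \<le> t0 + h" for s
    unfolding D_def using that le_r by (intro cSUP_upper bdd_aboveI2) auto
  have "D \<ge> 0" by (rule order.trans[OF zero_le_dist D[of t0]]) (use h in auto)
  have "D \<le> D / 2"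
    unfolding D_def[symmetric]
  proof (subst (1) D_def, rule cSUP_least)
    show "{t0..t0+h} \<noteq> {}" using h by simp
    fix s assume s: "s \<in> {t0..t0+h}"
    have "dist (v s) (u s) \<le> K * D * (s - t0)"
    proof (rule mild_solution_dist_le[OF u v _ _ t0 _ lip below])
      fix s' y assume s': "t0 \<le> s'" "s' \<le> s"
      have "cball (u s' y) r \<subseteq> E" using s s' t0 by (intro E T) auto
      moreover have "dist (u s' y) (v s' y) \<le> r"
        using le_r[of s'] dist_bounded[of "v s'" y "u s'"] s s' by (simp add: dist_commute)
      ultimately show "u s' y \<in> E" "v s' y \<in> E" using r by (auto simp: subset_iff)
    qed (use s T D in auto)
    also have "\<dots> \<le> K * D * h" using s K \<open>D \<ge> 0\<close> by (intro mult_left_mono) auto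
    also have "\<dots> \<le> D / 2" using mult_right_mono[OF h(4) \<open>D \<ge> 0\<close>] by (simp add: algebra_simps)
    finally show "dist (v s) (u s) \<le> D / 2" .
  qed
  hence "D \<le> 0" by simp
  hence eq: "v s = u s" if "t0 \<le> s" "s \<le> t0 + h" for s
    using D[OF that] by (metis dist_le_zero_iff order.trans)
  obtain b' where b': "b' \<in> B" "b' < t0 + h"
    using cInf_lessD[of B "t0 + h"] tB h by (auto simp: t0_def)
  have "t0 \<le> b'" unfolding t0_def by (rule cInf_lower[OF b'(1) bdd])
  with eq[of b'] b' show False by (auto simp: B_def)
qed

section \<open>The main theorem on Dirichlet L-functions\<close>

text \<open>The nearest-point projection onto the quadrant \<open>Re z \<ge> a\<close>, \<open>Im z \<ge> 0\<close>.\<close>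
definition quadrant_proj :: "real \<Rightarrow> complex \<Rightarrow> complex" where
  "quadrant_proj a z = Complex (max a (Re z)) (max 0 (Im z))"

lemma lipschitz_quadrant_proj: "1-lipschitz_on UNIV (quadrant_proj a)"
proof (rule lipschitz_onI)
  fix z w
  have "\<bar>max a x - max a y\<bar> \<le> \<bar>x - y\<bar>" for a x y :: real by (simp add: max_def)
  hence "sqrt ((max a (Re z) - max a (Re w))\<^sup>2 + (max 0 (Im z) - max 0 (Im w))\<^sup>2)
      \<le> sqrt ((Re z - Re w)\<^sup>2 + (Im z - Im w)\<^sup>2)"
    by (intro real_sqrt_le_mono add_mono) (simp_all flip: abs_le_square_iff)
  thus "dist (quadrant_proj a z) (quadrant_proj a w) \<le> 1 * dist z w"
    by (simp add: quadrant_proj_def dist_norm cmod_def)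
qed simp

lemma quadrant_proj_eq: "a \<le> Re z \<Longrightarrow> 0 \<le> Im z \<Longrightarrow> quadrant_proj a z = z"
  by (simp add: quadrant_proj_def complex_eq_iff)

lemma bcontfun_linear_bounds:
  fixes g :: "'a::topological_space \<Rightarrow>\<^sub>C 'b::real_normed_vector" and l :: "'b \<Rightarrow> real"
  assumes "bounded_linear l"
  shows "(INF x. l (g x)) \<le> l (g y)" and "l (g y) \<le> (SUP x. l (g x))"
proof -
  have "bounded (l ` range g)" by (intro bounded_linear_image assms) simp
  hence "bounded (range (\<lambda>x. l (g x)))" by (simp add: image_image)
  thus "(INF x. l (g x)) \<le> l (g y)" "l (g y) \<le> (SUP x. l (g x))"
    by (auto intro!: cINF_lower cSUP_upper bounded_imp_bdd_below bounded_imp_bdd_above)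
qed

theorem corollary1p5:
  fixes m :: nat and chi :: "nat \<Rightarrow> complex"
    and g :: "(real ^ 'd) \<Rightarrow>\<^sub>C complex"
    and I1 S1 I2 S2 :: real
  assumes "dirichlet_character m chi"
    and "\<forall>n\<ge>1. chi n \<in> \<real>"
    and "I1 = (INF x. Re (g x))" and "S1 = (SUP x. Re (g x))"
    and "I2 = (INF x. Im (g x))" and "S2 = (SUP x. Im (g x))"
    and "ereal I1 \<ge> max 1 (sigma0 (dirichlet_L chi))"
    and "I2 > 0"
  shows "\<exists>u. maximal_mild_solution (dirichlet_L chi) g \<infinity> u \<and>
           (\<forall>t\<ge>0. \<forall>x.
              max 0 (2 - Re (riemann_zeta (of_real I1))) * t + I1 \<le> Re (u t x) \<and>
              Re (u t x) \<le> Re (riemann_zeta (of_real I1)) * t + S1 \<and>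
              0 < Im (u t x) \<and>
              Im (u t x) \<le> (Re (riemann_zeta (of_real I1)) - 1) * t + S2)"
proof -
  let ?L = "dirichlet_L chi"
  note chi_le = dirichlet_character_norm_le_1[OF assms(1)]
  note chi_1 = dirichlet_character_1[OF assms(1)]
  have chi_real: "chi (Suc n) \<in> \<real>" for n using assms(2) by simp
  have sigma0: "Re s \<le> I1" if "Re s > 1" "Re (?L s) = 0" for s
  proof -
    have "\<not> is_pole ?L s" by (rule not_is_pole_dirichlet_L[of chi, OF chi_le that(1)])
    hence "ereal (Re s) \<le> sigma0 ?L"
      unfolding sigma0_def using that(2) by (intro Sup_upper) (auto intro!: exI[of _ "Im s"])
    also have "\<dots> \<le> ereal I1" using assms(7) by simp
    finally show ?thesis by simp
  qed
  \<comment> \<open>The set defining \<open>sigma0\<close> contains a number larger than 1.\<close>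
  have I1: "I1 > 1"
    using exists_zero_Re_dirichlet_L[OF assms(1)] sigma0 by force
  have nz: "Re (?L s) \<noteq> 0" if "I1 < Re s" for s
    using sigma0[of s] I1 that by auto
  have Re_nonneg: "0 \<le> Re (?L s)" if "I1 \<le> Re s" for s
    by (rule Re_dirichlet_L_nonneg[of chi I1, OF chi_le chi_1 I1 nz that])
  define Z where "Z = zeta_sum I1"
  define K where "K = log_zeta_sum I1"
  have Z: "Re (riemann_zeta (of_real I1)) = Z" by (simp add: Re_riemann_zeta I1 Z_def)
  have L_bound: "norm (?L s) \<le> Z" "norm (?L s - 1) \<le> Z - 1" if "I1 \<le> Re s" for s
    unfolding Z_def
    using norm_dirichlet_L_le[of chi, OF chi_le I1 that] norm_dirichlet_L_minus_1_le[of chi, OF chi_le I1 that chi_1]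
    by auto
  have L_Re: "max 0 (2 - Z) \<le> Re (?L s)" "Re (?L s) \<le> Z" and L_Im: "Im (?L s) \<le> Z - 1"
    if "I1 \<le> Re s" for s
    using Re_nonneg[OF that] L_bound[OF that] complex_Re_le_cmod[of "?L s"]
      abs_Re_le_cmod[of "?L s - 1"] abs_Im_le_cmod[of "?L s - 1"] by auto
  \<comment> \<open>This agrees with the L-function on the quadrant, where the solution will turn out to stay.\<close>
  define G where "G = (\<lambda>z. ?L (quadrant_proj I1 z))"
  have proj: "I1 \<le> Re (quadrant_proj I1 z)" for z by (simp add: quadrant_proj_def)
  interpret bounded_lipschitz G K Z
  proof
    have "(K * 1)-lipschitz_on UNIV (?L \<circ> quadrant_proj I1)"
      unfolding K_def
      by (intro lipschitz_on_compose lipschitz_quadrant_proj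
          lipschitz_on_subset[OF dirichlet_L_lipschitz[of chi, OF chi_le I1]]) (use proj in auto)
    thus "K-lipschitz_on UNIV G" by (simp add: G_def o_def)
    show "norm (G z) \<le> Z" for z unfolding G_def by (intro L_bound proj)
  qed
  obtain u where u: "u 0 = g" "continuous_on {0<..} u"
      "\<forall>t\<ge>0. u t = heat t g + duhamel (\<lambda>s. nemytskii (u s)) t"
    using exists_global_solution[of g] by blast
  interpret global_solution G K Z g u
    by unfold_locales (use u in auto)
  note g_bounds = bcontfun_linear_bounds[of Re g, OF bounded_linear_Re, folded assms(3,4)]
    bcontfun_linear_bounds[of Im g, OF bounded_linear_Im, folded assms(5,6)]
  have Re_u: "I1 \<le> Re (u t x)" if "t \<ge> 0" for t x
    using solution_ge[OF bounded_linear_Re g_bounds(1), of t 0 x] that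
    by (simp add: G_def Re_nonneg proj)
  have Im_u: "0 < Im (u t x)" if "t \<ge> 0" for t x
  proof (rule Im_solution_pos[OF _ assms(8) g_bounds(3) that])
    fix z :: complex assume z: "0 \<le> Im z"
    have "\<bar>Im (G z)\<bar> \<le> K * \<bar>Im (quadrant_proj I1 z)\<bar>"
      unfolding G_def K_def by (rule abs_Im_dirichlet_L_le[of chi, OF chi_le I1 proj chi_real])
    thus "- K * Im z \<le> Im (G z)" using z by (simp add: quadrant_proj_def abs_le_iff)
  qed
  have G_u: "G (u t x) = ?L (u t x)" if "t \<ge> 0" for t x
    using that by (simp add: G_def quadrant_proj_eq Re_u Im_u less_imp_le)
  have mild: "mild_solution ?L g \<infinity> u"
  proof (rule mild_solution)
    fix t :: real and x :: "real ^ 'd" assume t: "0 \<le> t"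
    show "?L (u t x) = G (u t x)" by (rule G_u[OF t, symmetric])
    show "\<not> is_pole ?L (u t x)"
      by (rule not_is_pole_dirichlet_L[of chi, OF chi_le order.strict_trans2[OF I1 Re_u[OF t]]])
  qed
  have "maximal_mild_solution ?L g \<infinity> u"
    unfolding maximal_mild_solution_def
  proof (intro conjI allI impI mild; (elim conjE)?)
    fix T' v and t :: real
    assume v: "mild_solution ?L g T' v" and t: "0 \<le> t" "ereal t < T'"
    \<comment> \<open>Half-way between the values of \<open>u\<close> and the line where the Lipschitz bound is lost.\<close>
    define a where "a = (1 + I1) / 2"
    have a: "1 < a" "a < I1" using I1 by (auto simp: a_def)
    show "v t = u t"
    proof (rule mild_solution_unique[OF mild v _ dirichlet_L_lipschitz[of chi, OF chi_le a(1)] _ _ t])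
      show "0 < I1 - a" using a by simp
      fix t :: real and x :: "real ^ 'd" assume "0 \<le> t"
      show "cball (u t x) (I1 - a) \<subseteq> {z. a \<le> Re z}"
      proof
        fix z assume "z \<in> cball (u t x) (I1 - a)"
        hence "\<bar>Re (u t x - z)\<bar> \<le> I1 - a"
          using abs_Re_le_cmod[of "u t x - z"] by (simp add: dist_norm)
        thus "z \<in> {z. a \<le> Re z}" using Re_u[OF \<open>0 \<le> t\<close>, of x] by simp
      qed
    qed simp
  qed simp_all
  moreover have "max 0 (2 - Z) * t + I1 \<le> Re (u t x)" "Re (u t x) \<le> Z * t + S1"
      "Im (u t x) \<le> (Z - 1) * t + S2" if t: "t \<ge> 0" for t x
  proof -
    have G: "max 0 (2 - Z) \<le> Re (G z)" "- Z \<le> - Re (G z)" "- (Z - 1) \<le> - Im (G z)" for z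
      using L_Re[OF proj] L_Im[OF proj] unfolding G_def neg_le_iff_le by blast+
    have g: "- S1 \<le> - Re (g y)" "- S2 \<le> - Im (g y)" for y
      using g_bounds by auto
    show "max 0 (2 - Z) * t + I1 \<le> Re (u t x)"
      using solution_ge[OF bounded_linear_Re g_bounds(1) G(1) t, of x] by linarith
    show "Re (u t x) \<le> Z * t + S1"
      using solution_ge[OF bounded_linear_minus[OF bounded_linear_Re] g(1) G(2) t, of x] by simp
    show "Im (u t x) \<le> (Z - 1) * t + S2"
      using solution_ge[OF bounded_linear_minus[OF bounded_linear_Im] g(2) G(3) t, of x]
      by (simp add: algebra_simps)
  qed
  ultimately show ?thesis using Im_u unfolding Z by blast
qed

end
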